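(* Let $\mathcal{X},\mathcal{Y},\mathcal{Z}$ be finite sets, $p_{XY}$ a probability mass function on $\mathcal{X}\times\mathcal{Y}$ and $p_{Z|XY}$ a conditional distribution on $\mathcal{Z}$, such that $p_X,p_Y,p_Z$ have full support. Any perfectly secure protocol for $(p_{XY},p_{Z|XY})$, if one exists, satisfies the following bounds on its rate $R^{\mathrm{PS}_1}:=\mathbb{E}[|M|]$: $$H_{\mathcal{X}}(G_{\mathrm{EQ}},X_{\mathrm{EQ}})\le R^{\mathrm{PS}_1}<H_{\mathcal{X}}(G_{\mathrm{EQ}},X_{\mathrm{EQ}})+1.$$
   Context: Protocols. Alice has input $X$ and Bob has input $Y$, with $(X,Y)\sim p_{XY}$. Each user has private randomness (the two users' private randomness and $(X,Y)$ are mutually independent). They communicate over a noiseless private link over multiple rounds; in each round one user sends a message (a finite binary string), which is a function of that user's input, private randomness and all messages exchanged so far. The messages of each round $t$ belong to a prefix-free code determined by the messages exchanged before. The transcript $M$ is the concatenation of all messages and $|M|$ its length in bits. At the end Bob outputs $Z$ as a function of his input, his private randomness and the transcript (so $Z-(Y,M)-X$ is a Markov chain). The rate $R^{\mathrm{PS}_1}$ of a perfectly secure protocol is the expected length $\mathbb{E}[|M|]$ of the transcript it generates. Entropies are in bits. Perfect security. A protocol is perfectly secure for $(p_{XY},p_{Z|XY})$ if the conditional distribution of the output $Z$ given $(X,Y)$ is $p_{Z|XY}$, and the Markov chains $M-X-(Y,Z)$ (privacy against Alice) and $M-(Y,Z)-X$ (privacy against Bob) hold. $(p_{XY},p_{Z|XY})$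 is computable with perfect security if such a protocol exists. Relation $\equiv$. For distinct $x,x'\in\mathcal{X}$ write $x\sim x'$ if there exist $y\in\mathcal{Y}$, $z\in\mathcal{Z}$ with $p_{XY}(x,y)$, $p_{XY}(x',y)$, $p_{Z|XY}(z|x,y)$, $p_{Z|XY}(z|x',y)$ all positive. Write $x\equiv x'$ if $x=x'$ or there is a sequence $x=x_1,\dots,x_l=x'$ with $x_i\sim x_{i+1}$ for all $i$. Let $\mathcal{X}_1,\dots,\mathcal{X}_k$ be the equivalence classes of $\equiv$. When $(p_{XY},p_{Z|XY})$ is computable with perfect security, for each $i$ and $y$ the distribution $p_{Z|XY}(\cdot|x,y)$ is the same for all $x\in\mathcal{X}_i$ with $p_{XY}(x,y)>0$. Reduced problem (defined when $(p_{XY},p_{Z|XY})$ is computable with perfect security). $\mathcal{X}_{\mathrm{EQ}}=\{x_1,\dots,x_k\}$ with $x_i$ a representative of $\mathcal{X}_i$; $X_{\mathrm{EQ}}$ is the random variable equal to $x_i$ when $X\in\mathcal{X}_i$. Thus $p_{X_{\mathrm{EQ}},Y}(x_i,y)=\sum_{x\in\mathcal{X}_i}p_{XY}(x,y)$. If there is $x\in\mathcal{X}_i$ with $p_{XY}(x,y)>0$, then $p_{Z|X_{\mathrm{EQ}},Y}(z|x_i,y):=p_{Z|XY}(z|x,y)$ for all $z$; otherwise it is set to $0$ for all $z$. Graph $G_{\mathrm{EQ}}$. The vertex set is $\mathcal{X}_{\mathrm{EQ}}$; $\{x_i,x_j\}$ is an edge iff there exists $(y,z)\in\mathcal{Y}\times\mathcal{Z}$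 with $p_{X_{\mathrm{EQ}},Y}(x_i,y)>0$, $p_{X_{\mathrm{EQ}},Y}(x_j,y)>0$ and $p_{Z|X_{\mathrm{EQ}},Y}(z|x_i,y)\ne p_{Z|X_{\mathrm{EQ}},Y}(z|x_j,y)$. Chromatic entropy. For a graph $G=(V,E)$ and a random variable $X$ on $V$, $H_{\mathcal{X}}(G,X):=\min\{H(c(X)) : c:V\to\mathbb{N}\text{ a proper coloring of }G\}$, where a coloring is proper if the endpoints of each edge receive distinct colors.
   Formalization: The upper bound is stated for some perfectly secure protocol (that is, for the optimal rate), not for every one: sending a long constant word first keeps a protocol perfectly secure but makes its rate exceed the bound; the lower bound holds for all. *)

theory Defs
  imports "HOL-Probability.Probability" "HOL-Library.Sublist"
begin

section \<open>Two-party protocols with one output at Bob\<close>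

datatype party = Alice | Bob

text \<open>
  A history is the list of the messages exchanged so far, oldest first.  The history determines
  who speaks next (or, by \<^term>\<open>None\<close>, that the protocol has ended) and the code from which the
  next message is taken.  The private randomness is an arbitrary probability space for each user.
\<close>

record ('x, 'y, 'z, 'a, 'b) protocol =
  randA :: "'a measure"
  randB :: "'b measure"
  turn :: "bool list list \<Rightarrow> party option"
  msg_code :: "bool list list \<Rightarrow> bool list set"
  msgA :: "'x \<Rightarrow> 'a \<Rightarrow> bool list list \<Rightarrow> bool list"
  msgB :: "'y \<Rightarrow> 'b \<Rightarrow> bool list list \<Rightarrow> bool list"
  outB :: "'y \<Rightarrow> 'b \<Rightarrow> bool list \<Rightarrow> 'z"

primrec history ::
  "('x, 'y, 'z, 'a, 'b) protocol \<Rightarrow> 'x \<Rightarrow> 'y \<Rightarrow> 'a \<Rightarrow> 'b \<Rightarrow> nat \<Rightarrow> bool list list" where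
  "history P x y a b 0 = []"
| "history P x y a b (Suc t) =
     (let h = history P x y a b t in
      case turn P h of
        None \<Rightarrow> h
      | Some Alice \<Rightarrow> h @ [msgA P x a h]
      | Some Bob \<Rightarrow> h @ [msgB P y b h])"

definition halts :: "('x, 'y, 'z, 'a, 'b) protocol \<Rightarrow> 'x \<Rightarrow> 'y \<Rightarrow> 'a \<Rightarrow> 'b \<Rightarrow> bool" where
  "halts P x y a b \<longleftrightarrow> (\<exists>t. turn P (history P x y a b t) = None)"

definition transcript ::
  "('x, 'y, 'z, 'a, 'b) protocol \<Rightarrow> 'x \<Rightarrow> 'y \<Rightarrow> 'a \<Rightarrow> 'b \<Rightarrow> bool list" where
  "transcript P x y a b =
     concat (history P x y a b (LEAST t. turn P (history P x y a b t) = None))"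

definition prefix_free :: "bool list set \<Rightarrow> bool" where
  "prefix_free C \<longleftrightarrow> (\<forall>u\<in>C. \<forall>v\<in>C. prefix u v \<longrightarrow> u = v)"

text \<open>
  The product measure makes the pair of inputs and the two private sources mutually independent.
\<close>

definition exec_space ::
  "('x \<times> 'y) pmf \<Rightarrow> ('x, 'y, 'z, 'a, 'b) protocol \<Rightarrow> (('x \<times> 'y) \<times> ('a \<times> 'b)) measure" where
  "exec_space pXY P = measure_pmf pXY \<Otimes>\<^sub>M (randA P \<Otimes>\<^sub>M randB P)"

definition rvX :: "('x \<times> 'y) \<times> ('a \<times> 'b) \<Rightarrow> 'x" where
  "rvX = (\<lambda>((x, y), (a, b)). x)"

definition rvY :: "('x \<times> 'y) \<times> ('a \<times> 'b) \<Rightarrow> 'y" where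
  "rvY = (\<lambda>((x, y), (a, b)). y)"

definition rvM ::
  "('x, 'y, 'z, 'a, 'b) protocol \<Rightarrow> ('x \<times> 'y) \<times> ('a \<times> 'b) \<Rightarrow> bool list" where
  "rvM P = (\<lambda>((x, y), (a, b)). transcript P x y a b)"

definition rvZ ::
  "('x, 'y, 'z, 'a, 'b) protocol \<Rightarrow> ('x \<times> 'y) \<times> ('a \<times> 'b) \<Rightarrow> 'z" where
  "rvZ P = (\<lambda>((x, y), (a, b)). outB P y b (transcript P x y a b))"

text \<open>
  The number of rounds may be random and unbounded, but the protocol ends almost surely.
\<close>

definition valid_protocol :: "('x \<times> 'y) pmf \<Rightarrow> ('x, 'y, 'z, 'a, 'b) protocol \<Rightarrow> bool" where
  "valid_protocol pXY P \<longleftrightarrow>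
     prob_space (randA P) \<and> prob_space (randB P) \<and>
     (\<forall>x h. (\<lambda>a. msgA P x a h) \<in> randA P \<rightarrow>\<^sub>M count_space UNIV) \<and>
     (\<forall>y h. (\<lambda>b. msgB P y b h) \<in> randB P \<rightarrow>\<^sub>M count_space UNIV) \<and>
     (\<forall>y m. (\<lambda>b. outB P y b m) \<in> randB P \<rightarrow>\<^sub>M count_space UNIV) \<and>
     (\<forall>h. prefix_free (msg_code P h)) \<and>
     (\<forall>x h. turn P h = Some Alice \<longrightarrow> (\<forall>a\<in>space (randA P). msgA P x a h \<in> msg_code P h)) \<and>
     (\<forall>y h. turn P h = Some Bob \<longrightarrow> (\<forall>b\<in>space (randB P). msgB P y b h \<in> msg_code P h)) \<and>
     (AE \<omega> in exec_space pXY P. case \<omega> of ((x, y), (a, b)) \<Rightarrow> halts P x y a b)"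

text \<open>
  The rate is an extended number, so that it is meaningful when the expected length is infinite.
\<close>

definition rate :: "('x \<times> 'y) pmf \<Rightarrow> ('x, 'y, 'z, 'a, 'b) protocol \<Rightarrow> ennreal" where
  "rate pXY P = (\<integral>\<^sup>+ \<omega>. of_nat (length (rvM P \<omega>)) \<partial>exec_space pXY P)"


section \<open>Perfect security\<close>

text \<open>
  Markov chain \<open>U - V - W\<close> for random variables with countable ranges.  If \<open>V = v\<close> has
  probability zero, all three conditional probabilities are 0 by the convention of
  \<^const>\<open>cond_prob\<close>, and the equation is trivial.
\<close>

definition markov_chain ::
  "'w measure \<Rightarrow> ('w \<Rightarrow> 'u) \<Rightarrow> ('w \<Rightarrow> 'v) \<Rightarrow> ('w \<Rightarrow> 't) \<Rightarrow> bool" where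
  "markov_chain \<Omega> U V W \<longleftrightarrow>
     (\<forall>u v w. \<P>(\<omega> in \<Omega>. U \<omega> = u \<and> W \<omega> = w \<bar> V \<omega> = v) =
        \<P>(\<omega> in \<Omega>. U \<omega> = u \<bar> V \<omega> = v) * \<P>(\<omega> in \<Omega>. W \<omega> = w \<bar> V \<omega> = v))"

definition perfectly_secure ::
  "('x \<times> 'y) pmf \<Rightarrow> ('x \<Rightarrow> 'y \<Rightarrow> 'z pmf) \<Rightarrow> ('x, 'y, 'z, 'a, 'b) protocol \<Rightarrow> bool" where
  "perfectly_secure pXY pZ P \<longleftrightarrow>
     valid_protocol pXY P \<and>
     (\<forall>x y z. pmf pXY (x, y) > 0 \<longrightarrow>
        \<P>(\<omega> in exec_space pXY P. rvZ P \<omega> = z \<bar> rvX \<omega> = x \<and> rvY \<omega> = y) = pmf (pZ x y) z) \<and>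
     markov_chain (exec_space pXY P) (rvM P) rvX (\<lambda>\<omega>. (rvY \<omega>, rvZ P \<omega>)) \<and>
     markov_chain (exec_space pXY P) (rvM P) (\<lambda>\<omega>. (rvY \<omega>, rvZ P \<omega>)) rvX"


section \<open>The reduced problem\<close>

definition sim ::
  "('x \<times> 'y) pmf \<Rightarrow> ('x \<Rightarrow> 'y \<Rightarrow> 'z pmf) \<Rightarrow> 'x \<Rightarrow> 'x \<Rightarrow> bool" where
  "sim pXY pZ x x' \<longleftrightarrow> x \<noteq> x' \<and>
     (\<exists>y z. pmf pXY (x, y) > 0 \<and> pmf pXY (x', y) > 0 \<and>
            pmf (pZ x y) z > 0 \<and> pmf (pZ x' y) z > 0)"

definition equivX ::
  "('x \<times> 'y) pmf \<Rightarrow> ('x \<Rightarrow> 'y \<Rightarrow> 'z pmf) \<Rightarrow> 'x \<Rightarrow> 'x \<Rightarrow> bool" where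
  "equivX pXY pZ = (sim pXY pZ)\<^sup>*\<^sup>*"

text \<open>
  A choice of one representative in each class: \<open>rep x\<close> is the representative of the class
  of \<open>x\<close>.  The alphabet of the reduced problem is \<open>range rep\<close>, and its input is
  \<open>rep X\<close>.
\<close>

definition representatives ::
  "('x \<times> 'y) pmf \<Rightarrow> ('x \<Rightarrow> 'y \<Rightarrow> 'z pmf) \<Rightarrow> ('x \<Rightarrow> 'x) \<Rightarrow> bool" where
  "representatives pXY pZ rep \<longleftrightarrow>
     (\<forall>x. equivX pXY pZ x (rep x)) \<and>
     (\<forall>x x'. equivX pXY pZ x x' \<longrightarrow> rep x = rep x')"

definition XEQ_pmf :: "('x \<times> 'y) pmf \<Rightarrow> ('x \<Rightarrow> 'x) \<Rightarrow> 'x pmf" where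
  "XEQ_pmf pXY rep = map_pmf (\<lambda>(x, y). rep x) pXY"

definition XEQY_pmf :: "('x \<times> 'y) pmf \<Rightarrow> ('x \<Rightarrow> 'x) \<Rightarrow> ('x \<times> 'y) pmf" where
  "XEQY_pmf pXY rep = map_pmf (\<lambda>(x, y). (rep x, y)) pXY"

text \<open>
  The choice of \<open>x\<close> below is immaterial whenever the problem is computable with perfect
  security.
\<close>

definition pZ_EQ ::
  "('x \<times> 'y) pmf \<Rightarrow> ('x \<Rightarrow> 'y \<Rightarrow> 'z pmf) \<Rightarrow> 'x \<Rightarrow> 'y \<Rightarrow> 'z \<Rightarrow> real" where
  "pZ_EQ pXY pZ xi y z =
     (if \<exists>x. equivX pXY pZ xi x \<and> pmf pXY (x, y) > 0
      then pmf (pZ (SOME x. equivX pXY pZ xi x \<and> pmf pXY (x, y) > 0) y) z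
      else 0)"

definition G_EQ_edges ::
  "('x \<times> 'y) pmf \<Rightarrow> ('x \<Rightarrow> 'y \<Rightarrow> 'z pmf) \<Rightarrow> ('x \<Rightarrow> 'x) \<Rightarrow> 'x set set" where
  "G_EQ_edges pXY pZ rep =
     {{xi, xj} | xi xj. xi \<in> range rep \<and> xj \<in> range rep \<and>
        (\<exists>y z. pmf (XEQY_pmf pXY rep) (xi, y) > 0 \<and> pmf (XEQY_pmf pXY rep) (xj, y) > 0 \<and>
               pZ_EQ pXY pZ xi y z \<noteq> pZ_EQ pXY pZ xj y z)}"


section \<open>Chromatic entropy\<close>

definition proper_coloring :: "'v set \<Rightarrow> 'v set set \<Rightarrow> ('v \<Rightarrow> nat) \<Rightarrow> bool" where
  "proper_coloring V E c \<longleftrightarrow> (\<forall>u\<in>V. \<forall>v\<in>V. {u, v} \<in> E \<longrightarrow> c u \<noteq> c v)"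

text \<open>
  \<open>p\<close> is the law of a random variable on \<open>V\<close>.  For finite \<open>V\<close> the infimum is a minimum:
  the entropy of a coloring depends only on the partition of \<open>V\<close> into color classes.
\<close>

definition chromatic_entropy :: "'v set \<Rightarrow> 'v set set \<Rightarrow> 'v pmf \<Rightarrow> real" where
  "chromatic_entropy V E p =
     Inf {prob_space.entropy (measure_pmf p) 2 (count_space (range c)) c | c.
            proper_coloring V E c}"

end

theory Submission
  imports Defs
begin

text \<open>
  Privacy against Alice makes the law of the transcript depend on \<open>x\<close> only, given that
  \<open>(x, y)\<close> is possible; privacy against Bob makes it agree for \<open>x \<sim> x'\<close>, hence on each class.
  Since the executions with a given transcript form a rectangle, Bob's output law given \<open>y\<close> and the
  transcript does not depend on \<open>x\<close>.  So inputs that share a possible \<open>y\<close> and a possible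
  transcript also share an output, i.e. are equivalent; and the output law is constant on classes.

  Lower bound: give each class its shortest possible transcript.  By the previous remark this is a
  proper colouring of \<open>G_EQ\<close>, its colours form a prefix-free code, and Kraft's inequality bounds
  its expected length from below by its entropy.

  Upper bound: Alice sends the Shannon codeword of the colour of her class in an optimal colouring;
  colour and \<open>y\<close> determine the output law, from which Bob samples.
\<close>

section \<open>Prefix-free codes and entropy\<close>

lemma card_extensions:
  fixes u :: "bool list"
  assumes "length u \<le> L"
  shows "card {v. length v = L \<and> prefix u v} = 2 ^ (L - length u)"
proof -
  have eq: "{v. length v = L \<and> prefix u v} = (@) u ` {v. length v = L - length u}"
    using assms by (auto simp: prefix_def)
  have "card {v :: bool list. length v = L - length u} = 2 ^ (L - length u)"
    using card_lists_length_eq[of "UNIV :: bool set" "L - length u"] by simp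
  moreover have "inj_on ((@) u) A" for A by (auto simp: inj_on_def)
  ultimately show ?thesis unfolding eq by (simp add: card_image)
qed

lemma finite_bool_lists: "finite {v :: bool list. length v = L}"
  using finite_lists_length_eq[of "UNIV :: bool set" L] by simp

lemma finite_extensions: "finite {v :: bool list. length v = L \<and> prefix u v}"
  by (rule finite_subset[OF _ finite_bool_lists[of L]]) auto

text \<open>Converts a count of extensions of a codeword into its Kraft weight, up to the common
  factor \<open>2 ^ L\<close>.\<close>

lemma power_half_diff:
  assumes "l \<le> L"
  shows "(2::real) ^ (L - l) = 2 ^ L * (1/2) ^ l"
  using assms by (simp add: power_diff power_one_over divide_simps)

text \<open>Extend every codeword in all ways to the maximal length \<open>L\<close>.
  Prefix-freeness makes the sets of extensions disjoint, and together they fit into the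
  \<open>2 ^ L\<close> words of that length.\<close>

lemma kraft_inequality:
  assumes "finite W" and "prefix_free W"
  shows "(\<Sum>w\<in>W. (1/2::real) ^ length w) \<le> 1"
proof -
  \<comment> \<open>Inserting 0 keeps the maximum defined when \<open>W\<close> is empty.\<close>
  define L where "L = Max (insert 0 (length ` W))"
  have L: "length w \<le> L" if "w \<in> W" for w
    unfolding L_def using that assms(1) by (intro Max_ge) auto
  let ?E = "\<lambda>w. {v :: bool list. length v = L \<and> prefix w v}"
  have disj: "?E w \<inter> ?E w' = {}" if "w \<in> W" "w' \<in> W" "w \<noteq> w'" for w w'
    using that assms(2) prefix_same_cases unfolding prefix_free_def by blast
  have "(\<Sum>w\<in>W. 2 ^ (L - length w)) = (\<Sum>w\<in>W. card (?E w))"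
    using L by (simp add: card_extensions)
  also have "\<dots> = card (\<Union>w\<in>W. ?E w)"
    using assms(1) disj finite_extensions by (subst card_UN_disjoint) auto
  also have "\<dots> \<le> card {v :: bool list. length v = L}"
    by (intro card_mono finite_bool_lists) auto
  also have "\<dots> = 2 ^ L"
    using card_lists_length_eq[of "UNIV :: bool set" L] by simp
  finally have "real (\<Sum>w\<in>W. 2 ^ (L - length w)) \<le> 2 ^ L"
    by (metis of_nat_le_iff of_nat_numeral of_nat_power)
  moreover have "real (\<Sum>w\<in>W. 2 ^ (L - length w)) = 2 ^ L * (\<Sum>w\<in>W. (1/2) ^ length w)"
    using L by (simp add: sum_distrib_left power_half_diff)
  ultimately show ?thesis by simp
qed

text \<open>Greedy construction in order of increasing length: the induction always adds a key with
  the largest required length, so the new word only has to avoid extending an earlier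
  codeword.\<close>

lemma kraft_converse:
  fixes l :: "'k \<Rightarrow> nat"
  assumes "finite K" and "(\<Sum>k\<in>K. (1/2::real) ^ l k) \<le> 1"
  shows "\<exists>w. (\<forall>k\<in>K. length (w k) = l k) \<and> inj_on w K \<and> prefix_free (w ` K)"
  using assms
proof (induction K rule: finite_ranking_induct[where f = l])
  case empty
  show ?case by (auto simp: prefix_free_def)
next
  case (insert k K)
  show ?case
  \<comment> \<open>The ranking induction allows the added key to be in the set already.\<close>
  proof (cases "k \<in> K")
    case True
    then show ?thesis using insert by (simp add: insert_absorb)
  next
    case False
    have sum: "(\<Sum>j\<in>K. (1/2::real) ^ l j) + (1/2) ^ l k \<le> 1"
      using insert.prems insert.hyps False by simp
    then have "(\<Sum>j\<in>K. (1/2::real) ^ l j) \<le> 1"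
      by (smt (verit) zero_le_power zero_le_divide_1_iff)
    then obtain w where w: "\<And>j. j \<in> K \<Longrightarrow> length (w j) = l j" "inj_on w K" "prefix_free (w ` K)"
      using insert.IH by blast
    \<comment> \<open>These are the words of length \<open>l k\<close> blocked by the codeword of
      \<open>j\<close>. Their total is \<open>2 ^ l k\<close> times the earlier Kraft sum, which is
      below 1 because \<open>k\<close> has positive weight itself; hence a free word
      \<open>v\<close> is left.\<close>
    let ?E = "\<lambda>j. {v :: bool list. length v = l k \<and> prefix (w j) v}"
    have "real (card (\<Union>j\<in>K. ?E j)) \<le> real (\<Sum>j\<in>K. card (?E j))"
      by (intro of_nat_mono card_UN_le insert.hyps)
    also have "\<dots> = 2 ^ l k * (\<Sum>j\<in>K. (1/2) ^ l j)"
      using w(1) insert.hyps by (simp add: card_extensions power_half_diff sum_distrib_left)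
    also have "\<dots> < 2 ^ l k * 1"
      using sum by (intro mult_strict_left_mono) (smt (verit) zero_less_power half_gt_zero, simp)
    finally have "card (\<Union>j\<in>K. ?E j) < card {v :: bool list. length v = l k}"
      using card_lists_length_eq[of "UNIV :: bool set" "l k"] by simp
    then have "\<not> {v :: bool list. length v = l k} \<subseteq> (\<Union>j\<in>K. ?E j)"
      using card_mono[of "\<Union>j\<in>K. ?E j"] insert.hyps(1) finite_extensions
      by (meson finite_UN_I leD)
    then obtain v where v: "length v = l k" "\<And>j. j \<in> K \<Longrightarrow> \<not> prefix (w j) v" by blast
    \<comment> \<open>The new word is at least as long as the earlier ones, so it could be a prefix
      of one only by equality.\<close>
    have v': "\<not> prefix v (w j)" if "j \<in> K" for j
    proof
      assume p: "prefix v (w j)"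
      then have "length v \<le> length (w j)" by (rule prefix_length_le)
      then have "length v = length (w j)" using v(1) w(1)[OF that] insert.hyps(2)[OF that] by simp
      then have "w j = v" using p by (metis prefix_def append_eq_append_conv append_Nil2)
      then show False using v(2)[OF that] by simp
    qed
    let ?w = "w(k := v)"
    have im: "?w ` insert k K = insert v (w ` K)" using False by auto
    have "prefix_free (?w ` insert k K)"
      unfolding im using w(3) v(2) v' unfolding prefix_free_def by auto
    moreover have "inj_on ?w (insert k K)"
      using w(2) False v(2) by (auto simp: inj_on_def)
    moreover have "\<forall>j\<in>insert k K. length (?w j) = l j" using w(1) v(1) by auto
    ultimately show ?thesis by blast
  qed
qed

section \<open>Entropy and expected codeword length\<close>

definition shannon_entropy :: "'k pmf \<Rightarrow> real" where
  "shannon_entropy D = - (\<Sum>k\<in>set_pmf D. pmf D k * log 2 (pmf D k))"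

text \<open>Gibbs' inequality against the weights 2^(-length), whose sum is at most 1 by Kraft's
  inequality.\<close>

lemma shannon_entropy_le_length:
  fixes w :: "'k \<Rightarrow> bool list"
  assumes fin: "finite (set_pmf D)" and "inj_on w (set_pmf D)" and "prefix_free (w ` set_pmf D)"
  shows "shannon_entropy D \<le> (\<Sum>k\<in>set_pmf D. pmf D k * length (w k))"
proof -
  have kraft: "(\<Sum>k\<in>set_pmf D. (1/2::real) ^ length (w k)) \<le> 1"
    using kraft_inequality[OF _ assms(3)] assms(2) fin by (simp add: sum.reindex)
  \<comment> \<open>Termwise form, from \<open>ln t \<le> t - 1\<close> at the ratio of the weight
    to the probability.\<close>
  have gibbs: "- (pmf D k * log 2 (pmf D k)) - pmf D k * length (w k)
      \<le> ((1/2) ^ length (w k) - pmf D k) / ln 2" if "k \<in> set_pmf D" for k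
  proof -
    let ?p = "pmf D k" and ?r = "(1/2::real) ^ length (w k)"
    have p: "?p > 0" using that by (simp add: pmf_positive)
    have "ln (?r / ?p) \<le> ?r / ?p - 1" using p by (intro ln_le_minus_one) simp
    then have "?p * ln (?r / ?p) \<le> ?r - ?p"
      using p by (simp add: field_simps)
    moreover have "ln (?r / ?p) = - length (w k) * ln 2 - ln ?p"
      using p by (simp add: ln_div ln_realpow)
    ultimately have "(?p * (- length (w k) * ln 2 - ln ?p)) / ln 2 \<le> (?r - ?p) / ln 2"
      by (intro divide_right_mono) auto
    then show ?thesis by (simp add: log_def algebra_simps diff_divide_distrib add_divide_distrib)
  qed
  have "shannon_entropy D - (\<Sum>k\<in>set_pmf D. pmf D k * length (w k))
      = (\<Sum>k\<in>set_pmf D. - (pmf D k * log 2 (pmf D k)) - pmf D k * length (w k))"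
    by (simp add: shannon_entropy_def sum_subtractf sum_negf)
  also have "\<dots> \<le> (\<Sum>k\<in>set_pmf D. ((1/2) ^ length (w k) - pmf D k) / ln 2)"
    by (rule sum_mono) (rule gibbs)
  also have "\<dots> = ((\<Sum>k\<in>set_pmf D. (1/2) ^ length (w k)) - 1) / ln 2"
    using fin sum_pmf_eq_1[of "set_pmf D" D] by (simp add: sum_subtractf flip: sum_divide_distrib)
  also have "\<dots> \<le> 0" using kraft by (simp add: divide_le_0_iff)
  finally show ?thesis by simp
qed

text \<open>The lengths obtained by rounding up \<open>- log 2 (pmf D k)\<close> satisfy Kraft's
  inequality, since 2^(-l) is at most the probability, and each rounding costs less than one
  bit.\<close>

lemma shannon_code:
  fixes D :: "'k pmf"
  assumes fin: "finite (set_pmf D)"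
  shows "\<exists>w :: 'k \<Rightarrow> bool list. inj_on w (set_pmf D) \<and> prefix_free (w ` set_pmf D) \<and>
    (\<Sum>k\<in>set_pmf D. pmf D k * length (w k)) < shannon_entropy D + 1"
proof -
  define l where "l k = nat \<lceil>- log 2 (pmf D k)\<rceil>" for k
  have pos: "pmf D k > 0" if "k \<in> set_pmf D" for k using that by (simp add: pmf_positive)
  \<comment> \<open>Probabilities are at most 1, so \<open>nat\<close> truncates nothing in
    \<open>l\<close>.\<close>
  have nonneg: "- log 2 (pmf D k) \<ge> 0" if "k \<in> set_pmf D" for k
    using pos[OF that] pmf_le_1[of D k] by simp
  have l: "- log 2 (pmf D k) \<le> l k" "l k < - log 2 (pmf D k) + 1" if "k \<in> set_pmf D" for k
    using nonneg[OF that] unfolding l_def by linarith+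
  have "(1/2::real) ^ l k \<le> pmf D k" if "k \<in> set_pmf D" for k
  proof -
    have "(1/2::real) ^ l k = 2 powr (- real (l k))"
      by (simp add: powr_minus powr_realpow power_one_over divide_simps)
    also have "\<dots> \<le> 2 powr (log 2 (pmf D k))" using l(1)[OF that] by (intro powr_mono) auto
    also have "\<dots> = pmf D k" using pos[OF that] by simp
    finally show ?thesis .
  qed
  then have "(\<Sum>k\<in>set_pmf D. (1/2::real) ^ l k) \<le> (\<Sum>k\<in>set_pmf D. pmf D k)" by (rule sum_mono)
  also have "\<dots> = 1" using fin by (intro sum_pmf_eq_1) auto
  finally obtain w where w: "\<And>k. k \<in> set_pmf D \<Longrightarrow> length (w k) = l k"
      "inj_on w (set_pmf D)" "prefix_free (w ` set_pmf D)"
    using kraft_converse[OF fin, of l] by blast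
  have "(\<Sum>k\<in>set_pmf D. pmf D k * length (w k))
      < (\<Sum>k\<in>set_pmf D. pmf D k * (- log 2 (pmf D k) + 1))"
    using fin pos l w(1) set_pmf_not_empty[of D]
    by (intro sum_strict_mono mult_strict_left_mono) auto
  also have "\<dots> = shannon_entropy D + 1"
    using fin sum_pmf_eq_1[of "set_pmf D" D]
    by (simp add: shannon_entropy_def right_diff_distrib sum_subtractf)
  finally show ?thesis using w by blast
qed

text \<open>Bridge from the density-based library entropy to a finite sum. Colours of probability
  zero drop out when the sum is restricted to the support.\<close>

lemma entropy_eq_shannon_entropy:
  fixes p :: "'v pmf" and c :: "'v \<Rightarrow> 'k"
  assumes "finite (range c)"
  shows "prob_space.entropy (measure_pmf p) 2 (count_space (range c)) c
    = shannon_entropy (map_pmf c p)"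
proof -
  interpret information_space "measure_pmf p" 2
    by unfold_locales auto
  let ?f = "pmf (map_pmf c p)"
  have sf: "simple_function (measure_pmf p) c"
    using assms by (simp add: simple_function_def)
  have "simple_distributed (measure_pmf p) c ?f"
    by (intro measure_pmf.simple_distributedI sf) (auto simp: pmf_map vimage_def)
  from entropy_simple_distributed[OF this]
  have "prob_space.entropy (measure_pmf p) 2 (count_space (range c)) c = - (\<Sum>k\<in>range c. ?f k * log 2 (?f k))" by simp
  also have "(\<Sum>k\<in>range c. ?f k * log 2 (?f k)) = (\<Sum>k\<in>set_pmf (map_pmf c p). ?f k * log 2 (?f k))"
    using assms by (intro sum.mono_neutral_right) (auto simp: pmf_eq_0_set_pmf)
  finally show ?thesis by (simp add: shannon_entropy_def)
qed

section \<open>Executions of a protocol\<close>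

text \<open>Keeps the message boundaries that concatenation into the transcript forgets. It is
  meaningful only for halting executions, as the \<open>LEAST\<close> is otherwise
  unspecified.\<close>

definition final_history ::
  "('x, 'y, 'z, 'a, 'b) protocol \<Rightarrow> 'x \<Rightarrow> 'y \<Rightarrow> 'a \<Rightarrow> 'b \<Rightarrow> bool list list" where
  "final_history P x y a b = history P x y a b (LEAST t. turn P (history P x y a b t) = None)"

lemma transcript_eq_concat: "transcript P x y a b = concat (final_history P x y a b)"
  by (simp add: transcript_def final_history_def)

text \<open>Mentions neither inputs nor randomness, so that parsing a transcript becomes a purely
  combinatorial question.\<close>

definition complete_history :: "('x, 'y, 'z, 'a, 'b) protocol \<Rightarrow> bool list list \<Rightarrow> bool" where
  "complete_history P h \<longleftrightarrow> turn P h = None \<and>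
     (\<forall>t<length h. turn P (take t h) \<noteq> None \<and> h ! t \<in> msg_code P (take t h))"

text \<open>Parse both strings from the left: equal histories so far use the same prefix-free code,
  so the next messages agree as well. Hence transcripts form a prefix-free set and determine their
  histories.\<close>

lemma complete_history_prefix:
  assumes codes: "\<And>h. prefix_free (msg_code P h)"
    and h: "complete_history P h" and h': "complete_history P h'"
    and pre: "prefix (concat h) (concat h')"
  shows "h = h'"
proof -
  have eq: "take t h = take t h'" if "t \<le> length h" "t \<le> length h'" for t
    using that
  proof (induction t)
    case (Suc t)
    then have IH: "take t h = take t h'" and lt: "t < length h" "t < length h'" by auto
    let ?u = "concat (take t h)"
    have "concat h = ?u @ (h ! t) @ concat (drop (Suc t) h)"
      using lt(1) by (metis append_take_drop_id concat_append Cons_nth_drop_Suc concat.simps(2))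
    then have 1: "prefix (?u @ (h ! t)) (concat h')" using pre
      by (metis append.assoc append_prefixD)
    have "concat h' = ?u @ (h' ! t) @ concat (drop (Suc t) h')"
      using lt(2) IH by (metis append_take_drop_id concat_append Cons_nth_drop_Suc concat.simps(2))
    then have 2: "prefix (?u @ (h' ! t)) (concat h')" by (metis append.assoc prefixI)
    have "prefix (h ! t) (h' ! t) \<or> prefix (h' ! t) (h ! t)"
      using prefix_same_cases[OF 1 2] by simp
    moreover have "h ! t \<in> msg_code P (take t h)" "h' ! t \<in> msg_code P (take t h)"
      using h h' lt IH by (auto simp: complete_history_def)
    ultimately have "h ! t = h' ! t" using codes[of "take t h"] unfolding prefix_free_def by metis
    then show ?case using IH lt by (simp add: take_Suc_conv_app_nth)
  qed simp
  have turn: "turn P h = None" "turn P h' = None" using h h' by (auto simp: complete_history_def)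
  \<comment> \<open>If one history were a proper initial segment of the other, the protocol would
    already have ended there.\<close>
  consider "length h < length h'" | "length h' < length h" | "length h = length h'" by linarith
  then show ?thesis
  proof cases
    case 1
    then have "take (length h) h' = h" using eq[of "length h"] by simp
    then show ?thesis using h' 1 turn unfolding complete_history_def by metis
  next
    case 2
    then have "take (length h') h = h'" using eq[of "length h'"] by simp
    then show ?thesis using h 2 turn unfolding complete_history_def by metis
  next
    case 3
    then show ?thesis using eq[of "length h"] by simp
  qed
qed

text \<open>Alice's side of the rectangle of executions that lead to \<open>h\<close>: it constrains
  only her input and randomness. \<open>bob_agrees\<close> is the other side.\<close>

definition alice_agrees :: "('x, 'y, 'z, 'a, 'b) protocol \<Rightarrow> 'x \<Rightarrow> 'a \<Rightarrow> bool list list \<Rightarrow> bool" where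
  "alice_agrees P x a h \<longleftrightarrow>
     (\<forall>t<length h. turn P (take t h) = Some Alice \<longrightarrow> msgA P x a (take t h) = h ! t)"

definition bob_agrees :: "('x, 'y, 'z, 'a, 'b) protocol \<Rightarrow> 'y \<Rightarrow> 'b \<Rightarrow> bool list list \<Rightarrow> bool" where
  "bob_agrees P y b h \<longleftrightarrow>
     (\<forall>t<length h. turn P (take t h) = Some Bob \<longrightarrow> msgB P y b (take t h) = h ! t)"

text \<open>As long as the protocol has not ended, each round appends exactly one message, so the
  history at time \<open>t\<close> contains all earlier ones as initial segments.\<close>

lemma history_take:
  assumes "\<And>s. s < t \<Longrightarrow> turn P (history P x y a b s) \<noteq> None"
  shows "length (history P x y a b t) = t \<and>
    (\<forall>s\<le>t. history P x y a b s = take s (history P x y a b t))"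
  using assms
proof (induction t)
  case (Suc t)
  let ?h = "history P x y a b"
  have "length (?h t) = t \<and> (\<forall>s\<le>t. ?h s = take s (?h t))"
    by (rule Suc.IH, rule Suc.prems) simp
  then have IH: "length (?h t) = t" "\<And>s. s \<le> t \<Longrightarrow> ?h s = take s (?h t)"
    by blast+
  obtain m where m: "?h (Suc t) = ?h t @ [m]"
    using Suc.prems[of t] by (cases "the (turn P (?h t))") (auto simp: Let_def)
  show ?case
  proof (intro conjI allI impI)
    show "length (?h (Suc t)) = Suc t" using IH(1) m by simp
    fix s assume s: "s \<le> Suc t"
    show "?h s = take s (?h (Suc t))"
    proof (cases "s = Suc t")
      case True
      then show ?thesis using IH(1) m by (metis le_refl length_append_singleton take_all)
    next
      case False
      then have "s \<le> t" using s by simp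
      then have "take s (?h (Suc t)) = take s (?h t)" unfolding m using IH(1) by simp
      with IH(2)[OF \<open>s \<le> t\<close>] show ?thesis by (rule trans[OF _ sym])
    qed
  qed
qed simp

lemma final_history_step:
  assumes halts: "halts P x y a b" and h: "final_history P x y a b = h"
  shows "turn P h = None"
    and "t < length h \<Longrightarrow> turn P (take t h) = Some Alice \<and> msgA P x a (take t h) = h ! t \<or>
           turn P (take t h) = Some Bob \<and> msgB P y b (take t h) = h ! t"
proof -
  let ?h = "history P x y a b"
  define T where "T = (LEAST t. turn P (?h t) = None)"
  have hT: "?h T = h" using h by (simp add: final_history_def T_def)
  have T: "turn P (?h T) = None"
    using halts unfolding halts_def T_def by (rule LeastI_ex)
  then show "turn P h = None" using hT by simp
  have nT: "turn P (?h s) \<noteq> None" if "s < T" for s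
    using that not_less_Least unfolding T_def by blast
  have len: "length h = T" and take: "\<And>s. s \<le> T \<Longrightarrow> ?h s = take s h"
    using history_take[of T P x y a b] nT hT by auto
  show "turn P (take t h) = Some Alice \<and> msgA P x a (take t h) = h ! t \<or>
           turn P (take t h) = Some Bob \<and> msgB P y b (take t h) = h ! t" if t: "t < length h"
  proof -
    have "turn P (take t h) \<noteq> None" using nT[of t] take[of t] t len by simp
    moreover have "?h (Suc t) = take t h @ [h ! t]"
      using take[of "Suc t"] t len by (simp add: take_Suc_conv_app_nth)
    ultimately show ?thesis
      using take[of t] t len by (auto simp: Let_def split: option.splits party.splits)
  qed
qed

lemma final_history_complete:
  assumes valid: "valid_protocol pXY P"
    and "halts P x y a b" "a \<in> space (randA P)" "b \<in> space (randB P)"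
  shows "complete_history P (final_history P x y a b)"
  unfolding complete_history_def
proof (intro conjI allI impI)
  let ?f = "final_history P x y a b"
  show "turn P ?f = None" using final_history_step(1)[OF assms(2)] by simp
  fix t assume t: "t < length ?f"
  note step = final_history_step(2)[OF assms(2) refl t]
  then show "turn P (take t ?f) \<noteq> None" by auto
  show "?f ! t \<in> msg_code P (take t ?f)"
    using step valid assms(3,4) unfolding valid_protocol_def by metis
qed

text \<open>Every message depends on the input and randomness of one user only, so reaching
  \<open>h\<close> splits into a condition on \<open>(x, a)\<close> and one on
  \<open>(y, b)\<close>.\<close>

lemma final_history_iff:
  assumes h: "complete_history P h"
  shows "halts P x y a b \<and> final_history P x y a b = h \<longleftrightarrow> alice_agrees P x a h \<and> bob_agrees P y b h"
proof
  assume "halts P x y a b \<and> final_history P x y a b = h"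
  then show "alice_agrees P x a h \<and> bob_agrees P y b h"
    using final_history_step(2)[of P x y a b h]
    by (fastforce simp: alice_agrees_def bob_agrees_def)
next
  assume agree: "alice_agrees P x a h \<and> bob_agrees P y b h"
  let ?h = "history P x y a b"
  have take: "?h t = take t h" if "t \<le> length h" for t
    using that
  proof (induction t)
    case (Suc t)
    then have IH: "?h t = take t h" and t: "t < length h" by auto
    have "turn P (take t h) \<noteq> None" using h t by (simp add: complete_history_def)
    moreover have "turn P (take t h) = Some Alice \<Longrightarrow> msgA P x a (take t h) = h ! t"
        "turn P (take t h) = Some Bob \<Longrightarrow> msgB P y b (take t h) = h ! t"
      using agree t by (auto simp: alice_agrees_def bob_agrees_def)
    ultimately show ?case using IH t
      by (auto simp: Let_def take_Suc_conv_app_nth split: option.split party.split)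
  qed simp
  have "turn P (?h (length h)) = None" using take[of "length h"] h by (simp add: complete_history_def)
  \<comment> \<open>Completeness of \<open>h\<close> excludes an earlier stop, so the
    \<open>LEAST\<close> stopping time is \<open>length h\<close>.\<close>
  moreover have "length h \<le> t" if "turn P (?h t) = None" for t
  proof (rule ccontr)
    assume "\<not> length h \<le> t"
    then have "turn P (take t h) \<noteq> None" using h by (simp add: complete_history_def)
    then show False using take[of t] that \<open>\<not> length h \<le> t\<close> by simp
  qed
  ultimately have "(LEAST t. turn P (?h t) = None) = length h"
    by (rule Least_equality)
  then show "halts P x y a b \<and> final_history P x y a b = h"
    using take[of "length h"] \<open>turn P (?h (length h)) = None\<close>
    by (auto simp: final_history_def halts_def intro!: exI[of _ "length h"])
qed

section \<open>Measurability of histories, transcripts and outputs\<close>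

definition rand_space :: "('x, 'y, 'z, 'a, 'b) protocol \<Rightarrow> ('a \<times> 'b) measure" where
  "rand_space P = randA P \<Otimes>\<^sub>M randB P"

text \<open>There are countably many histories, so a round may be treated separately for each fixed
  earlier history, where only one user's message is random.\<close>

lemma history_measurable:
  assumes valid: "valid_protocol pXY P"
  shows "(\<lambda>ab. history P x y (fst ab) (snd ab) t) \<in> rand_space P \<rightarrow>\<^sub>M count_space UNIV"
proof (induction t)
  case (Suc t)
  have [measurable]: "(\<lambda>a. msgA P x a h) \<in> randA P \<rightarrow>\<^sub>M count_space UNIV"
      "(\<lambda>b. msgB P y b h) \<in> randB P \<rightarrow>\<^sub>M count_space UNIV" for h
    using valid by (auto simp: valid_protocol_def)
  let ?f = "\<lambda>h ab. case turn P h of None \<Rightarrow> h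
      | Some Alice \<Rightarrow> h @ [msgA P x (fst ab) h] | Some Bob \<Rightarrow> h @ [msgB P y (snd ab) h]"
  have "(\<lambda>ab. ?f h ab) \<in> rand_space P \<rightarrow>\<^sub>M count_space UNIV" for h
    unfolding rand_space_def by (auto split: option.split party.split)
  from measurable_compose_countable[where f = ?f, OF this Suc]
  show ?case unfolding history.simps Let_def .
qed simp

lemma final_history_measurable:
  assumes valid: "valid_protocol pXY P"
  shows "(\<lambda>ab. final_history P x y (fst ab) (snd ab)) \<in> rand_space P \<rightarrow>\<^sub>M count_space UNIV"
proof -
  note [measurable] = history_measurable[OF valid]
  have "(\<lambda>ab. LEAST t. turn P (history P x y (fst ab) (snd ab) t) = None)
      \<in> rand_space P \<rightarrow>\<^sub>M count_space UNIV"
    by measurable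
  from measurable_compose_countable[where f = "\<lambda>t ab. history P x y (fst ab) (snd ab) t",
      OF history_measurable[OF valid] this]
  show ?thesis by (simp add: final_history_def)
qed

lemma transcript_measurable:
  assumes valid: "valid_protocol pXY P"
  shows "(\<lambda>ab. transcript P x y (fst ab) (snd ab)) \<in> rand_space P \<rightarrow>\<^sub>M count_space UNIV"
  unfolding transcript_eq_concat
  by (rule measurable_compose[OF final_history_measurable[OF valid]]) simp

lemma output_measurable:
  assumes valid: "valid_protocol pXY P"
  shows "(\<lambda>ab. outB P y (snd ab) (transcript P x y (fst ab) (snd ab)))
    \<in> rand_space P \<rightarrow>\<^sub>M count_space UNIV"
proof -
  have [measurable]: "(\<lambda>b. outB P y b m) \<in> randB P \<rightarrow>\<^sub>M count_space UNIV" for m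
    using valid by (auto simp: valid_protocol_def)
  have "(\<lambda>ab. outB P y (snd ab) m) \<in> rand_space P \<rightarrow>\<^sub>M count_space UNIV" for m
    unfolding rand_space_def by measurable
  from measurable_compose_countable[where f = "\<lambda>m ab. outB P y (snd ab) m",
      OF this transcript_measurable[OF valid]]
  show ?thesis .
qed

section \<open>The probability space of executions\<close>

locale execution =
  fixes pXY :: "('x::finite \<times> 'y::finite) pmf"
    and P :: "('x, 'y, 'z::finite, 'a, 'b) protocol"
  assumes valid: "valid_protocol pXY P"
begin

abbreviation "\<Omega> \<equiv> exec_space pXY P"
abbreviation "AB \<equiv> rand_space P"

sublocale A: prob_space "randA P"
  using valid by (simp add: valid_protocol_def)

sublocale B: prob_space "randB P"
  using valid by (simp add: valid_protocol_def)

sublocale AB: prob_space AB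
  unfolding rand_space_def by (intro prob_space_pair A.prob_space_axioms B.prob_space_axioms)

lemma exec_space_eq: "\<Omega> = measure_pmf pXY \<Otimes>\<^sub>M AB"
  by (simp add: exec_space_def rand_space_def)

sublocale exec: prob_space \<Omega>
  unfolding exec_space_eq by (intro prob_space_pair AB.prob_space_axioms prob_space_measure_pmf)

text \<open>The input alphabets are finite, so measurability may be checked for each fixed pair of
  inputs.\<close>

lemma exec_measurable:
  assumes "\<And>xy. (\<lambda>ab. f (xy, ab)) \<in> AB \<rightarrow>\<^sub>M N"
  shows "f \<in> \<Omega> \<rightarrow>\<^sub>M N"
proof -
  have 1: "(\<lambda>\<omega>. f (xy, snd \<omega>)) \<in> \<Omega> \<rightarrow>\<^sub>M N" for xy
    unfolding exec_space_eq by (rule measurable_compose[OF measurable_snd assms])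
  have 2: "fst \<in> \<Omega> \<rightarrow>\<^sub>M count_space UNIV"
    unfolding exec_space_eq
    by (rule measurable_compose[OF measurable_fst, of "\<lambda>x. x", simplified]) simp
  have "(\<lambda>\<omega>. f (fst \<omega>, snd \<omega>)) \<in> \<Omega> \<rightarrow>\<^sub>M N"
    by (rule measurable_compose_countable[where f = "\<lambda>xy \<omega>. f (xy, snd \<omega>)", OF 1 2])
  then show ?thesis by simp
qed

lemma rvM_slice: "rvM P ((x, y), ab) = transcript P x y (fst ab) (snd ab)"
  by (simp add: rvM_def split: prod.split)

lemma rvZ_slice: "rvZ P ((x, y), ab) = outB P y (snd ab) (transcript P x y (fst ab) (snd ab))"
  by (simp add: rvZ_def split: prod.split)

lemma rvX_slice [simp]: "rvX ((x, y), ab) = x"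
  by (simp add: rvX_def split: prod.split)

lemma rvY_slice [simp]: "rvY ((x, y), ab) = y"
  by (simp add: rvY_def split: prod.split)

lemma rvM_measurable [measurable]: "rvM P \<in> \<Omega> \<rightarrow>\<^sub>M count_space UNIV"
  by (rule exec_measurable) (auto simp: rvM_slice transcript_measurable[OF valid])

lemma rvZ_measurable [measurable]: "rvZ P \<in> \<Omega> \<rightarrow>\<^sub>M count_space UNIV"
  by (rule exec_measurable) (auto simp: rvZ_slice output_measurable[OF valid])

lemma rvX_measurable [measurable]: "rvX \<in> \<Omega> \<rightarrow>\<^sub>M count_space UNIV"
  by (rule exec_measurable) auto

lemma rvY_measurable [measurable]: "rvY \<in> \<Omega> \<rightarrow>\<^sub>M count_space UNIV"
  by (rule exec_measurable) auto

lemma measure_slice: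
  assumes "Measurable.pred AB (\<lambda>ab. Q ((x, y), ab))"
  shows "measure \<Omega> {\<omega> \<in> space \<Omega>. Q \<omega> \<and> rvX \<omega> = x \<and> rvY \<omega> = y}
    = pmf pXY (x, y) * measure AB {ab \<in> space AB. Q ((x, y), ab)}"
proof -
  have eq: "{\<omega> \<in> space \<Omega>. Q \<omega> \<and> rvX \<omega> = x \<and> rvY \<omega> = y} = {(x, y)} \<times> {ab \<in> space AB. Q ((x, y), ab)}"
    unfolding exec_space_eq by (auto simp: space_pair_measure)
  have "emeasure \<Omega> ({(x, y)} \<times> {ab \<in> space AB. Q ((x, y), ab)})
      = emeasure (measure_pmf pXY) {(x, y)} * emeasure AB {ab \<in> space AB. Q ((x, y), ab)}"
    unfolding exec_space_eq using assms by (intro AB.emeasure_pair_measure_Times) auto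
  then show ?thesis unfolding eq
    by (simp add: measure_def enn2real_mult emeasure_pmf_single)
qed

text \<open>Fubini's theorem for null sets, read at an atom of the input law.\<close>

lemma AE_slice:
  assumes "AE \<omega> in \<Omega>. R \<omega>" and "pmf pXY (x, y) > 0"
  shows "AE ab in AB. R ((x, y), ab)"
proof -
  interpret pair_sigma_finite "measure_pmf pXY" AB
    by (intro pair_sigma_finite.intro AB.sigma_finite_measure_axioms
        measure_pmf.sigma_finite_measure_axioms)
  have "AE xy in measure_pmf pXY. AE ab in AB. R (xy, ab)"
    using AE_pair assms(1) unfolding exec_space_eq by blast
  then show ?thesis using assms(2) by (simp add: AE_measure_pmf_iff set_pmf_iff)
qed

lemma AE_halts:
  assumes "pmf pXY (x, y) > 0"
  shows "AE ab in AB. halts P x y (fst ab) (snd ab)"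
  using AE_slice[OF _ assms, of "\<lambda>\<omega>. case \<omega> of ((x, y), (a, b)) \<Rightarrow> halts P x y a b"] valid
  by (simp add: valid_protocol_def case_prod_beta)

text \<open>The law of transcript and output at fixed inputs, taken over the private randomness
  alone, so that no conditioning on the inputs is involved.\<close>

definition joint :: "'x \<Rightarrow> 'y \<Rightarrow> bool list \<Rightarrow> 'z \<Rightarrow> real" where
  "joint x y m z = measure AB {ab \<in> space AB. rvM P ((x, y), ab) = m \<and> rvZ P ((x, y), ab) = z}"

lemma measure_joint:
  "measure \<Omega> {\<omega> \<in> space \<Omega>. (rvM P \<omega> = m \<and> rvZ P \<omega> = z) \<and> rvX \<omega> = x \<and> rvY \<omega> = y}
    = pmf pXY (x, y) * joint x y m z"
proof -
  note [measurable] = transcript_measurable[OF valid] output_measurable[OF valid]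
  show ?thesis unfolding joint_def
    by (rule measure_slice) (simp add: rvM_slice rvZ_slice)
qed

lemma measure_XY: "measure \<Omega> {\<omega> \<in> space \<Omega>. rvX \<omega> = x \<and> rvY \<omega> = y} = pmf pXY (x, y)"
  using measure_slice[of "\<lambda>_. True" x y] by (simp add: AB.prob_space)

lemma AE_final_history:
  assumes "pmf pXY (x, y) > 0"
  shows "AE ab in AB. halts P x y (fst ab) (snd ab) \<and>
    complete_history P (final_history P x y (fst ab) (snd ab))"
  using AE_halts[OF assms] AE_space
proof eventually_elim
  case (elim ab)
  then show ?case
    using final_history_complete[OF valid, of x y "fst ab" "snd ab"]
    by (auto simp: rand_space_def space_pair_measure)
qed

lemma complete_history_inj:
  assumes "complete_history P h" "complete_history P h'" "prefix (concat h) (concat h')"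
  shows "h = h'"
  using complete_history_prefix[OF _ assms] valid by (simp add: valid_protocol_def)

text \<open>
  For fixed inputs the executions with a given transcript form a rectangle, one side determined by
  the randomness and input of each user.
\<close>

lemma joint_factorization:
  obtains \<alpha> :: "'x \<Rightarrow> bool list \<Rightarrow> real" and \<beta> :: "'y \<Rightarrow> bool list \<Rightarrow> 'z \<Rightarrow> real"
  where "\<And>x m. \<alpha> x m \<ge> 0" and "\<And>y m z. \<beta> y m z \<ge> 0"
    and "\<And>x m. \<alpha> x m > 0 \<Longrightarrow> \<exists>h. complete_history P h \<and> concat h = m"
    and "\<And>x y m z. pmf pXY (x, y) > 0 \<Longrightarrow> joint x y m z = \<alpha> x m * \<beta> y m z"
proof -
  let ?ex = "\<lambda>m. \<exists>h. complete_history P h \<and> concat h = m"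
  \<comment> \<open>By \<open>complete_history_inj\<close> a transcript has at most one parse, so
    the choice is canonical whenever a parse exists.\<close>
  define hist where "hist m = (SOME h. complete_history P h \<and> concat h = m)" for m
  \<comment> \<open>The value 0 for strings without a parse makes positivity of \<alpha> a
    certificate that \<open>m\<close> is the transcript of a complete history.\<close>
  define \<alpha> where "\<alpha> x m = (if ?ex m then measure (randA P) {a \<in> space (randA P). alice_agrees P x a (hist m)} else 0)" for x m
  \<comment> \<open>For a given transcript the output depends only on \<open>y\<close> and
    \<open>b\<close>, so the event on \<open>z\<close> belongs to Bob's side.\<close>
  define \<beta> where "\<beta> y m z = measure (randB P) {b \<in> space (randB P). bob_agrees P y b (hist m) \<and> outB P y b m = z}" for y m z
  have "joint x y m z = \<alpha> x m * \<beta> y m z" if pos: "pmf pXY (x, y) > 0" for x y m z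
  proof (cases "?ex m")
    case False
    have "AE ab in AB. \<not> (rvM P ((x, y), ab) = m \<and> rvZ P ((x, y), ab) = z)"
      using AE_final_history[OF pos]
      by eventually_elim (use False in \<open>auto simp: rvM_slice transcript_eq_concat\<close>)
    from AB.prob_eq_0_AE[OF this] show ?thesis
      using False by (auto simp: joint_def \<alpha>_def)
  next
    case True
    define h where "h = hist m"
    have h: "complete_history P h" "concat h = m"
      using someI_ex[OF True] by (auto simp: h_def hist_def)
    note [measurable] = transcript_measurable[OF valid] output_measurable[OF valid]
    have [measurable]: "(\<lambda>a. msgA P x a h) \<in> randA P \<rightarrow>\<^sub>M count_space UNIV"
      "(\<lambda>b. msgB P y b h) \<in> randB P \<rightarrow>\<^sub>M count_space UNIV"
      "(\<lambda>b. outB P y b m) \<in> randB P \<rightarrow>\<^sub>M count_space UNIV" for h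
      using valid by (auto simp: valid_protocol_def)
    let ?SA = "{a \<in> space (randA P). alice_agrees P x a h}"
    let ?SB = "{b \<in> space (randB P). bob_agrees P y b h \<and> outB P y b m = z}"
    have SA: "?SA \<in> sets (randA P)" unfolding alice_agrees_def by measurable
    have SB: "?SB \<in> sets (randB P)" unfolding bob_agrees_def by measurable
    have "joint x y m z = measure AB (?SA \<times> ?SB)"
      unfolding joint_def
    proof (rule measure_eq_AE)
      show "{ab \<in> space AB. rvM P ((x, y), ab) = m \<and> rvZ P ((x, y), ab) = z} \<in> sets AB"
        unfolding rvM_slice rvZ_slice by measurable
      show "?SA \<times> ?SB \<in> sets AB"
        unfolding rand_space_def using SA SB by (rule pair_measureI)
      show "AE ab in AB. ab \<in> {ab \<in> space AB. rvM P ((x, y), ab) = m \<and> rvZ P ((x, y), ab) = z}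
          \<longleftrightarrow> ab \<in> ?SA \<times> ?SB"
        using AE_final_history[OF pos] AE_space
      proof eventually_elim
        case (elim ab)
        let ?a = "fst ab" and ?b = "snd ab"
        have "transcript P x y ?a ?b = m \<longleftrightarrow> final_history P x y ?a ?b = h"
          using complete_history_inj[of "final_history P x y ?a ?b" h] elim h
          by (auto simp: transcript_eq_concat)
        also have "\<dots> \<longleftrightarrow> alice_agrees P x ?a h \<and> bob_agrees P y ?b h"
          using final_history_iff[OF h(1), of x y ?a ?b] elim by blast
        finally show ?case using elim
          by (cases ab) (auto simp: rvM_slice rvZ_slice rand_space_def space_pair_measure)
      qed
    qed
    also have "\<dots> = measure (randA P) ?SA * measure (randB P) ?SB"
      unfolding rand_space_def
      using B.emeasure_pair_measure_Times[OF SA SB] by (simp add: measure_def enn2real_mult)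
    also have "\<dots> = \<alpha> x m * \<beta> y m z" using True by (simp add: \<alpha>_def \<beta>_def h_def)
    finally show ?thesis .
  qed
  moreover have "?ex m" if "\<alpha> x m > 0" for x m
  proof (rule ccontr)
    assume "\<not> ?ex m"
    then have "\<alpha> x m = 0" unfolding \<alpha>_def by (rule if_not_P)
    then show False using that by simp
  qed
  moreover have "\<alpha> x m \<ge> 0" "\<beta> y m z \<ge> 0" for x y m z
    unfolding \<alpha>_def \<beta>_def by simp_all
  ultimately show ?thesis by (intro that[of \<alpha> \<beta>])
qed

end

section \<open>Consequences of perfect security\<close>

lemma (in execution) measure_output:
  assumes correct: "\<P>(\<omega> in \<Omega>. rvZ P \<omega> = z \<bar> rvX \<omega> = x \<and> rvY \<omega> = y) = r"
    and pos: "pmf pXY (x, y) > 0"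
  shows "measure \<Omega> {\<omega> \<in> space \<Omega>. rvZ P \<omega> = z \<and> rvX \<omega> = x \<and> rvY \<omega> = y} = pmf pXY (x, y) * r"
proof -
  have "measure \<Omega> {\<omega> \<in> space \<Omega>. rvZ P \<omega> = z \<and> rvX \<omega> = x \<and> rvY \<omega> = y} / pmf pXY (x, y) = r"
    using correct unfolding cond_prob_def by (simp add: measure_XY)
  then show ?thesis using pos by (simp add: field_simps)
qed

locale secure_execution = execution pXY P
  for pXY :: "('x::finite \<times> 'y::finite) pmf" and P :: "('x, 'y, 'z::finite, 'a, 'b) protocol" +
  fixes pZ :: "'x \<Rightarrow> 'y \<Rightarrow> 'z pmf"
  assumes secure: "perfectly_secure pXY pZ P"
    and full_X: "set_pmf (map_pmf fst pXY) = UNIV"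
begin

lemma ex_input_pos: "\<exists>y. pmf pXY (x, y) > 0"
proof -
  have "x \<in> fst ` set_pmf pXY" using full_X by simp
  then obtain y where "(x, y) \<in> set_pmf pXY" by auto
  then show ?thesis by (intro exI[of _ y] pmf_positive)
qed

lemma ex_output_pos: "\<exists>z. pmf (pZ x y) z > 0"
  using set_pmf_not_empty[of "pZ x y"] pmf_positive by fastforce

lemma measure_XYZ:
  assumes "pmf pXY (x, y) > 0"
  shows "measure \<Omega> {\<omega> \<in> space \<Omega>. rvZ P \<omega> = z \<and> rvX \<omega> = x \<and> rvY \<omega> = y}
    = pmf pXY (x, y) * pmf (pZ x y) z"
  using measure_output[OF _ assms] secure assms unfolding perfectly_secure_def by blast

lemma measure_X_pos: "measure \<Omega> {\<omega> \<in> space \<Omega>. rvX \<omega> = x} > 0"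
proof -
  obtain y where "pmf pXY (x, y) > 0" using ex_input_pos by blast
  then have "0 < measure \<Omega> {\<omega> \<in> space \<Omega>. rvX \<omega> = x \<and> rvY \<omega> = y}" by (simp add: measure_XY)
  also have "\<dots> \<le> measure \<Omega> {\<omega> \<in> space \<Omega>. rvX \<omega> = x}"
    by (intro exec.finite_measure_mono) auto
  finally show ?thesis .
qed

text \<open>Full support of \<open>X\<close> makes this a genuine conditional law for every
  \<open>x\<close>.\<close>

definition msg_law :: "'x \<Rightarrow> bool list \<Rightarrow> real" where
  "msg_law x m = \<P>(\<omega> in \<Omega>. rvM P \<omega> = m \<bar> rvX \<omega> = x)"

text \<open>Privacy against Alice: given \<open>X\<close>, the transcript is independent of
  \<open>(Y, Z)\<close>. Clearing the positive denominators gives the product.\<close>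

lemma joint_eq_msg_law:
  assumes pos: "pmf pXY (x, y) > 0"
  shows "joint x y m z = msg_law x m * pmf (pZ x y) z"
proof -
  let ?PX = "measure \<Omega> {\<omega> \<in> space \<Omega>. rvX \<omega> = x}"
  have "\<P>(\<omega> in \<Omega>. rvM P \<omega> = m \<and> (rvY \<omega>, rvZ P \<omega>) = (y, z) \<bar> rvX \<omega> = x)
      = msg_law x m * \<P>(\<omega> in \<Omega>. (rvY \<omega>, rvZ P \<omega>) = (y, z) \<bar> rvX \<omega> = x)"
    using secure unfolding perfectly_secure_def markov_chain_def msg_law_def by blast
  moreover have "{\<omega> \<in> space \<Omega>. (rvM P \<omega> = m \<and> (rvY \<omega>, rvZ P \<omega>) = (y, z)) \<and> rvX \<omega> = x}
      = {\<omega> \<in> space \<Omega>. (rvM P \<omega> = m \<and> rvZ P \<omega> = z) \<and> rvX \<omega> = x \<and> rvY \<omega> = y}"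
    by auto
  moreover have "{\<omega> \<in> space \<Omega>. (rvY \<omega>, rvZ P \<omega>) = (y, z) \<and> rvX \<omega> = x}
      = {\<omega> \<in> space \<Omega>. rvZ P \<omega> = z \<and> rvX \<omega> = x \<and> rvY \<omega> = y}"
    by auto
  ultimately have "pmf pXY (x, y) * joint x y m z / ?PX
      = msg_law x m * (pmf pXY (x, y) * pmf (pZ x y) z / ?PX)"
    unfolding cond_prob_def by (simp only: measure_joint measure_XYZ[OF pos])
  then show ?thesis using pos measure_X_pos[of x] by (simp add: field_simps)
qed

text \<open>Privacy against Bob: the conditional law of the transcript given \<open>(y, z)\<close>
  is the same for every \<open>x\<close> that can occur with them. Positivity of the output
  probability makes the conditioning event non-null.\<close>

lemma joint_eq_cond_YZ:
  assumes pos: "pmf pXY (x, y) > 0" "pmf (pZ x y) z > 0"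
  shows "joint x y m z = \<P>(\<omega> in \<Omega>. rvM P \<omega> = m \<bar> (rvY \<omega>, rvZ P \<omega>) = (y, z)) * pmf (pZ x y) z"
proof -
  let ?PYZ = "measure \<Omega> {\<omega> \<in> space \<Omega>. (rvY \<omega>, rvZ P \<omega>) = (y, z)}"
  let ?r = "\<P>(\<omega> in \<Omega>. rvM P \<omega> = m \<bar> (rvY \<omega>, rvZ P \<omega>) = (y, z))"
  have "0 < measure \<Omega> {\<omega> \<in> space \<Omega>. rvZ P \<omega> = z \<and> rvX \<omega> = x \<and> rvY \<omega> = y}"
    using pos by (simp add: measure_XYZ)
  also have "\<dots> \<le> ?PYZ"
    by (intro exec.finite_measure_mono) auto
  finally have PYZ: "?PYZ > 0" .
  have "\<P>(\<omega> in \<Omega>. rvM P \<omega> = m \<and> rvX \<omega> = x \<bar> (rvY \<omega>, rvZ P \<omega>) = (y, z))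
      = ?r * \<P>(\<omega> in \<Omega>. rvX \<omega> = x \<bar> (rvY \<omega>, rvZ P \<omega>) = (y, z))"
    using secure unfolding perfectly_secure_def markov_chain_def by blast
  moreover have "{\<omega> \<in> space \<Omega>. (rvM P \<omega> = m \<and> rvX \<omega> = x) \<and> (rvY \<omega>, rvZ P \<omega>) = (y, z)}
      = {\<omega> \<in> space \<Omega>. (rvM P \<omega> = m \<and> rvZ P \<omega> = z) \<and> rvX \<omega> = x \<and> rvY \<omega> = y}"
    by auto
  moreover have "{\<omega> \<in> space \<Omega>. rvX \<omega> = x \<and> (rvY \<omega>, rvZ P \<omega>) = (y, z)}
      = {\<omega> \<in> space \<Omega>. rvZ P \<omega> = z \<and> rvX \<omega> = x \<and> rvY \<omega> = y}"
    by auto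
  ultimately have "pmf pXY (x, y) * joint x y m z / ?PYZ
      = ?r * (pmf pXY (x, y) * pmf (pZ x y) z / ?PYZ)"
    \<comment> \<open>Only these instances are unfolded, so that \<open>?r\<close> stays intact as a
      common factor.\<close>
    unfolding cond_prob_def[of _ "\<lambda>\<omega>. _ \<omega> \<and> _ \<omega>"] cond_prob_def[of _ "\<lambda>\<omega>. rvX \<omega> = x"]
    by (simp only: measure_joint measure_XYZ[OF pos(1)])
  then have "pmf pXY (x, y) * joint x y m z = pmf pXY (x, y) * (?r * pmf (pZ x y) z)"
    using PYZ by (simp add: field_simps)
  then show ?thesis using pos(1) by simp
qed

text \<open>At a pair \<open>(y, z)\<close> common to both inputs, the two privacy conditions
  identify each law with the conditional law given \<open>(y, z)\<close>.\<close>

lemma msg_law_sim: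
  assumes "sim pXY pZ x x'"
  shows "msg_law x = msg_law x'"
proof
  fix m
  obtain y z where yz: "pmf pXY (x, y) > 0" "pmf pXY (x', y) > 0"
      "pmf (pZ x y) z > 0" "pmf (pZ x' y) z > 0"
    using assms by (auto simp: sim_def)
  let ?r = "\<P>(\<omega> in \<Omega>. rvM P \<omega> = m \<bar> (rvY \<omega>, rvZ P \<omega>) = (y, z))"
  have "msg_law x m = ?r"
    using joint_eq_msg_law[OF yz(1), of m z] joint_eq_cond_YZ[OF yz(1,3), of m] yz(3) by simp
  moreover have "msg_law x' m = ?r"
    using joint_eq_msg_law[OF yz(2), of m z] joint_eq_cond_YZ[OF yz(2,4), of m] yz(4) by simp
  ultimately show "msg_law x m = msg_law x' m" by simp
qed

lemma msg_law_equiv: "equivX pXY pZ x x' \<Longrightarrow> msg_law x = msg_law x'"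
  unfolding equivX_def by (induction rule: rtranclp_induct) (auto simp: msg_law_sim)

text \<open>Each pair \<open>(x, m)\<close> of conditional probability zero is avoided almost
  surely, and there are only countably many pairs.\<close>

lemma AE_msg_law_pos: "AE \<omega> in \<Omega>. msg_law (rvX \<omega>) (rvM P \<omega>) > 0"
proof -
  have "AE \<omega> in \<Omega>. \<not> (rvM P \<omega> = m \<and> rvX \<omega> = x)" if "msg_law x m = 0" for x m
  proof -
    have "\<P>(\<omega> in \<Omega>. rvM P \<omega> = m \<and> rvX \<omega> = x) = 0"
      using that measure_X_pos[of x] by (simp add: msg_law_def cond_prob_def)
    then show ?thesis by (subst (asm) exec.prob_Collect_eq_0) auto
  qed
  then have "AE \<omega> in \<Omega>. msg_law x m = 0 \<longrightarrow> \<not> (rvM P \<omega> = m \<and> rvX \<omega> = x)" for x m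
    by (cases "msg_law x m = 0") auto
  then have "AE \<omega> in \<Omega>. \<forall>x m. msg_law x m = 0 \<longrightarrow> \<not> (rvM P \<omega> = m \<and> rvX \<omega> = x)"
    unfolding AE_all_countable by blast
  then show ?thesis
  proof eventually_elim
    case (elim \<omega>)
    moreover have "msg_law (rvX \<omega>) (rvM P \<omega>) \<ge> 0" by (simp add: msg_law_def cond_prob_def)
    ultimately show ?case by (metis order_le_less)
  qed
qed

lemma ex_msg_law_pos: "\<exists>m. msg_law x m > 0"
proof (rule ccontr)
  assume none: "\<nexists>m. msg_law x m > 0"
  have "AE \<omega> in \<Omega>. \<not> rvX \<omega> = x"
    using AE_msg_law_pos by eventually_elim (use none in auto)
  from exec.prob_eq_0_AE[OF this] show False using measure_X_pos[of x] by simp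
qed

text \<open>A possible transcript, combined with a possible \<open>y\<close> and \<open>z\<close>,
  has positive joint probability; then its factor \<alpha> is positive and \<open>m\<close> has a
  parse.\<close>

lemma msg_law_complete:
  assumes "msg_law x m > 0"
  shows "\<exists>h. complete_history P h \<and> concat h = m"
proof -
  obtain \<alpha> \<beta> where ab: "\<And>x m. \<alpha> x m \<ge> 0" "\<And>y m z. \<beta> y m z \<ge> 0"
    "\<And>x m. \<alpha> x m > 0 \<Longrightarrow> \<exists>h. complete_history P h \<and> concat h = m"
    "\<And>x y m z. pmf pXY (x, y) > 0 \<Longrightarrow> joint x y m z = \<alpha> x m * \<beta> y m z"
    using joint_factorization by blast
  obtain y where y: "pmf pXY (x, y) > 0" using ex_input_pos by blast
  obtain z where z: "pmf (pZ x y) z > 0" using ex_output_pos by blast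
  have "\<alpha> x m * \<beta> y m z > 0"
    using joint_eq_msg_law[OF y, of m z] ab(4)[OF y, of m z] assms z by simp
  then show ?thesis using ab(1)[of x m] ab(3)[of x m] by (cases "\<alpha> x m = 0") auto
qed

text \<open>Ranging over all inputs at once allows one transcript to be picked per class while the
  picks still form a prefix-free code.\<close>

lemma msg_law_prefix_free: "prefix_free {m. \<exists>x. msg_law x m > 0}"
  unfolding prefix_free_def using msg_law_complete complete_history_inj by blast

text \<open>Bob's factor \<open>\<beta> y m\<close> is shared by both inputs, so an output possible
  for \<open>x\<close> is possible for \<open>x'\<close> too and witnesses
  \<open>sim\<close>.\<close>

lemma msg_law_common:
  assumes pos: "pmf pXY (x, y) > 0" "pmf pXY (x', y) > 0"
    and m: "msg_law x m > 0" "msg_law x' m > 0"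
  shows "equivX pXY pZ x x'"
proof -
  obtain \<alpha> \<beta> where ab: "\<And>x m. \<alpha> x m \<ge> 0" "\<And>y m z. \<beta> y m z \<ge> 0"
    "\<And>x m. \<alpha> x m > 0 \<Longrightarrow> \<exists>h. complete_history P h \<and> concat h = m"
    "\<And>x y m z. pmf pXY (x, y) > 0 \<Longrightarrow> joint x y m z = \<alpha> x m * \<beta> y m z"
    using joint_factorization by blast
  have fact: "\<alpha> x m * \<beta> y m z = msg_law x m * pmf (pZ x y) z"
      "\<alpha> x' m * \<beta> y m z = msg_law x' m * pmf (pZ x' y) z" for z
    using joint_eq_msg_law[of _ y m z] ab(4)[of _ y m z] pos by simp_all
  \<comment> \<open>The output \<open>z\<close> forces \<beta> to be positive there, and
    \<open>z'\<close> forces \<open>\<alpha> x' m\<close> to be positive; their product transfers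
    \<open>z\<close> to \<open>x'\<close>.\<close>
  obtain z where z: "pmf (pZ x y) z > 0" using ex_output_pos by blast
  obtain z' where z': "pmf (pZ x' y) z' > 0" using ex_output_pos by blast
  have "\<alpha> x m * \<beta> y m z > 0" using fact(1) z m by simp
  then have "\<beta> y m z > 0" using ab(1)[of x m] ab(2)[of y m z] by (simp add: zero_less_mult_iff)
  moreover have "\<alpha> x' m * \<beta> y m z' > 0" using fact(2) z' m by simp
  then have "\<alpha> x' m > 0" using ab(1)[of x' m] ab(2)[of y m z'] by (simp add: zero_less_mult_iff)
  ultimately have "msg_law x' m * pmf (pZ x' y) z > 0" by (simp flip: fact(2))
  then have "pmf (pZ x' y) z > 0" using m(2) by (simp add: zero_less_mult_iff)
  then have "x = x' \<or> sim pXY pZ x x'" using z pos unfolding sim_def by blast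
  then show ?thesis by (auto simp: equivX_def)
qed

text \<open>Fix a transcript possible for the whole class. Summing the factorization over
  \<open>z\<close> removes the output law and shows that both inputs have the same \<alpha>; the
  output laws then agree termwise.\<close>

lemma pZ_equiv:
  assumes pos: "pmf pXY (x, y) > 0" "pmf pXY (x', y) > 0" and eq: "equivX pXY pZ x x'"
  shows "pZ x y = pZ x' y"
proof (rule pmf_eqI)
  fix z
  obtain \<alpha> \<beta> where ab: "\<And>x m. \<alpha> x m \<ge> 0" "\<And>y m z. \<beta> y m z \<ge> 0"
    "\<And>x m. \<alpha> x m > 0 \<Longrightarrow> \<exists>h. complete_history P h \<and> concat h = m"
    "\<And>x y m z. pmf pXY (x, y) > 0 \<Longrightarrow> joint x y m z = \<alpha> x m * \<beta> y m z"
    using joint_factorization by blast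
  obtain m where m: "msg_law x m > 0" using ex_msg_law_pos by blast
  let ?g = "msg_law x m"
  have fact: "\<alpha> x m * \<beta> y m z = ?g * pmf (pZ x y) z"
      "\<alpha> x' m * \<beta> y m z = ?g * pmf (pZ x' y) z" for z
    using joint_eq_msg_law[of _ y m z] ab(4)[of _ y m z] pos msg_law_equiv[OF eq] by simp_all
  have sum: "(\<Sum>z\<in>UNIV. pmf q z) = 1" for q :: "'z pmf" by (rule sum_pmf_eq_1) auto
  have "\<alpha> x m * (\<Sum>z\<in>UNIV. \<beta> y m z) = ?g * (\<Sum>z\<in>UNIV. pmf (pZ x y) z)"
      "\<alpha> x' m * (\<Sum>z\<in>UNIV. \<beta> y m z) = ?g * (\<Sum>z\<in>UNIV. pmf (pZ x' y) z)"
    by (simp_all only: sum_distrib_left fact)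
  then have "\<alpha> x m * (\<Sum>z\<in>UNIV. \<beta> y m z) = ?g" "\<alpha> x' m * (\<Sum>z\<in>UNIV. \<beta> y m z) = ?g"
    by (simp_all only: sum mult_1_right)
  then have "\<alpha> x m = \<alpha> x' m" using m by (metis mult_cancel_right less_irrefl mult_zero_right)
  then show "pmf (pZ x y) z = pmf (pZ x' y) z"
    using fact[of z] m by simp
qed

end

section \<open>One-message protocols\<close>

text \<open>Given \<open>V = v\<close>, the event \<open>U = u\<close> is almost surely either
  certain or impossible, and in both cases the product formula holds.\<close>

lemma (in prob_space) markov_chain_function:
  assumes U: "\<And>u. Measurable.pred M (\<lambda>\<omega>. U \<omega> = u)"
    and V: "\<And>v. Measurable.pred M (\<lambda>\<omega>. V \<omega> = v)"
    and W: "\<And>w. Measurable.pred M (\<lambda>\<omega>. W \<omega> = w)"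
    and f: "AE \<omega> in M. U \<omega> = f (V \<omega>)"
  shows "markov_chain M U V W"
  unfolding markov_chain_def
proof (intro allI)
  fix u v w
  note [measurable] = U V W
  show "\<P>(\<omega> in M. U \<omega> = u \<and> W \<omega> = w \<bar> V \<omega> = v)
      = \<P>(\<omega> in M. U \<omega> = u \<bar> V \<omega> = v) * \<P>(\<omega> in M. W \<omega> = w \<bar> V \<omega> = v)"
  proof (cases "f v = u")
    case True
    have "\<P>(\<omega> in M. (U \<omega> = u \<and> W \<omega> = w) \<and> V \<omega> = v) = \<P>(\<omega> in M. W \<omega> = w \<and> V \<omega> = v)"
    proof (rule measure_eq_AE)
      show "AE x in M. (x \<in> {\<omega> \<in> space M. (U \<omega> = u \<and> W \<omega> = w) \<and> V \<omega> = v}) =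
          (x \<in> {\<omega> \<in> space M. W \<omega> = w \<and> V \<omega> = v})"
        using f by eventually_elim (use True in auto)
    qed measurable
    moreover have "\<P>(\<omega> in M. U \<omega> = u \<and> V \<omega> = v) = \<P>(\<omega> in M. V \<omega> = v)"
    proof (rule measure_eq_AE)
      show "AE x in M. (x \<in> {\<omega> \<in> space M. U \<omega> = u \<and> V \<omega> = v}) = (x \<in> {\<omega> \<in> space M. V \<omega> = v})"
        using f by eventually_elim (use True in auto)
    qed measurable
    ultimately show ?thesis unfolding cond_prob_def by (simp only:) simp
  next
    case False
    have "\<P>(\<omega> in M. (U \<omega> = u \<and> W \<omega> = w) \<and> V \<omega> = v) = 0"
      by (rule prob_eq_0_AE) (use f in \<open>eventually_elim, use False in auto\<close>)
    moreover have "\<P>(\<omega> in M. U \<omega> = u \<and> V \<omega> = v) = 0"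
      by (rule prob_eq_0_AE) (use f in \<open>eventually_elim, use False in auto\<close>)
    ultimately show ?thesis unfolding cond_prob_def by (simp only:)
  qed
qed

text \<open>Reduces expected lengths that depend on Alice's input alone to expectations under the
  law of \<open>X\<close>.\<close>

lemma (in execution) nn_integral_rvX:
  fixes f :: "'x \<Rightarrow> real"
  assumes "\<And>x. f x \<ge> 0"
  shows "(\<integral>\<^sup>+\<omega>. ennreal (f (rvX \<omega>)) \<partial>\<Omega>) = ennreal (\<integral>x. f x \<partial>measure_pmf (map_pmf fst pXY))"
proof -
  have "(\<integral>\<^sup>+\<omega>. ennreal (f (rvX \<omega>)) \<partial>\<Omega>) = (\<integral>\<^sup>+\<omega>. ennreal (f (fst (fst \<omega>))) \<partial>(measure_pmf pXY \<Otimes>\<^sub>M AB))"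
    unfolding exec_space_eq rvX_def by (simp add: case_prod_beta)
  also have "\<dots> = (\<integral>\<^sup>+xy. ennreal (f (fst xy)) \<partial>distr (measure_pmf pXY \<Otimes>\<^sub>M AB) (measure_pmf pXY) fst)"
    by (subst nn_integral_distr) auto
  also have "\<dots> = (\<integral>\<^sup>+x. ennreal (f x) \<partial>measure_pmf (map_pmf fst pXY))"
    by (simp add: AB.distr_pair_fst)
  also have "\<dots> = ennreal (\<integral>x. f x \<partial>measure_pmf (map_pmf fst pXY))"
    using assms by (intro nn_integral_eq_integral integrable_measure_pmf_finite) auto
  finally show ?thesis .
qed

context
  fixes pXY :: "('x::finite \<times> 'y::finite) pmf"
    and pZ :: "'x \<Rightarrow> 'y \<Rightarrow> 'z::finite pmf"
    and F :: "'x \<Rightarrow> bool list"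
begin

text \<open>
  Bob's randomness encodes in a real number one independent sample of every
  \<open>pZ x y\<close>; he outputs the sample for \<open>y\<close> and some input \<open>x\<close> that explains the message.
\<close>

definition sample_pmf :: "real pmf" where
  "sample_pmf = map_pmf (\<lambda>f. real (to_nat f))
     (Pi_pmf (UNIV :: ('x \<times> 'y) set) undefined (\<lambda>(x, y). pZ x y))"

text \<open>The floor recovers the code number from the real; reals that encode no sample have
  probability zero under \<open>sample_pmf\<close>.\<close>

definition sample :: "real \<Rightarrow> 'x \<times> 'y \<Rightarrow> 'z" where
  "sample b = from_nat (nat \<lfloor>b\<rfloor>)"

definition one_message_protocol :: "('x, 'y, 'z, real, real) protocol" where
  "one_message_protocol =
    \<lparr>randA = measure_pmf (return_pmf 0), randB = measure_pmf sample_pmf,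
     turn = (\<lambda>h. if h = [] then Some Alice else None),
     msg_code = (\<lambda>h. if h = [] then range F else {}),
     msgA = (\<lambda>x a h. F x), msgB = (\<lambda>y b h. []),
     outB = (\<lambda>y b m. sample b (SOME x. pmf pXY (x, y) > 0 \<and> F x = m, y))\<rparr>"

lemma map_sample_pmf: "map_pmf (\<lambda>b. sample b (x, y)) sample_pmf = pZ x y"
proof -
  have "map_pmf (\<lambda>b. sample b (x, y)) sample_pmf
      = map_pmf (\<lambda>f. f (x, y)) (Pi_pmf (UNIV :: ('x \<times> 'y) set) undefined (\<lambda>(x, y). pZ x y))"
    unfolding sample_pmf_def by (simp add: map_pmf_comp sample_def)
  then show ?thesis by (simp add: Pi_pmf_component)
qed

lemma one_message_final_history:
  "halts one_message_protocol x y a b \<and> final_history one_message_protocol x y a b = [F x]"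
proof -
  have "complete_history one_message_protocol [F x]"
    by (simp add: complete_history_def one_message_protocol_def)
  from final_history_iff[OF this, of x y a b] show ?thesis
    by (simp add: alice_agrees_def bob_agrees_def one_message_protocol_def)
qed

lemma one_message_transcript: "transcript one_message_protocol x y a b = F x"
  using one_message_final_history by (simp add: transcript_eq_concat)

section \<open>Validity, rate and security of the one-message protocol\<close>

context
  assumes prefix_free: "prefix_free (range F)"
begin

lemma one_message_valid: "valid_protocol pXY one_message_protocol"
proof -
  have "halts one_message_protocol x y a b" for x y a b
    using one_message_final_history by blast
  then show ?thesis
    using prefix_free unfolding valid_protocol_def
    by (auto simp: one_message_protocol_def prob_space_measure_pmf prefix_free_def)
qed

interpretation Q: execution pXY one_message_protocol
  by standard (rule one_message_valid)

lemma one_message_rvM: "rvM one_message_protocol \<omega> = F (rvX \<omega>)"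
  by (simp add: rvM_def rvX_def one_message_transcript split: prod.split)

lemma one_message_rate:
  "rate pXY one_message_protocol = ennreal (\<integral>x. real (length (F x)) \<partial>measure_pmf (map_pmf fst pXY))"
  unfolding rate_def one_message_rvM
  using Q.nn_integral_rvX[of "\<lambda>x. real (length (F x))"] by (simp add: ennreal_of_nat_eq_real_of_nat)

context
  assumes compatible: "\<And>x x' y. pmf pXY (x, y) > 0 \<Longrightarrow> pmf pXY (x', y) > 0 \<Longrightarrow> F x = F x' \<Longrightarrow>
    pZ x y = pZ x' y"
    and respects: "\<And>x x'. sim pXY pZ x x' \<Longrightarrow> F x = F x'"
begin

text \<open>The input Bob guesses from the message may differ from \<open>x\<close>, but
  \<open>compatible\<close> gives it the same output law at \<open>y\<close>.\<close>

lemma one_message_measure_XYZ: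
  "measure (exec_space pXY one_message_protocol)
    {\<omega> \<in> space (exec_space pXY one_message_protocol).
      rvZ one_message_protocol \<omega> = z \<and> rvX \<omega> = x \<and> rvY \<omega> = y} = pmf pXY (x, y) * pmf (pZ x y) z"
proof (cases "pmf pXY (x, y) = 0")
  case False
  then have pos: "pmf pXY (x, y) > 0" using pmf_nonneg[of pXY "(x, y)"] by linarith
  let ?P = one_message_protocol and ?x = "SOME x'. pmf pXY (x', y) > 0 \<and> F x' = F x"
  have x: "pmf pXY (?x, y) > 0 \<and> F ?x = F x"
    by (rule someI[where x = x]) (simp add: pos)
  let ?S = "{b. sample b (?x, y) = z}"
  have "rvZ ?P ((x, y), ab) = sample (snd ab) (?x, y)" for ab
    by (simp add: Q.rvZ_slice one_message_transcript) (simp add: one_message_protocol_def)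
  then have "{ab \<in> space Q.AB. rvZ ?P ((x, y), ab) = z} = space (randA ?P) \<times> ?S"
    by (auto simp: rand_space_def space_pair_measure) (simp_all add: one_message_protocol_def)
  moreover have "measure Q.AB (space (randA ?P) \<times> ?S) = measure (randB ?P) ?S"
    unfolding rand_space_def
    using Q.B.emeasure_pair_measure_Times[of "space (randA ?P)" "randA ?P" ?S] Q.A.emeasure_space_1
    by (simp add: measure_def one_message_protocol_def)
  moreover have "measure (randB ?P) ?S = pmf (map_pmf (\<lambda>b. sample b (?x, y)) sample_pmf) z"
    by (simp add: one_message_protocol_def pmf_map vimage_def)
  moreover have "pZ ?x y = pZ x y"
    using compatible[of ?x y x] x pos by blast
  moreover have "Measurable.pred Q.AB (\<lambda>ab. rvZ ?P ((x, y), ab) = z)"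
    unfolding Q.rvZ_slice using output_measurable[OF one_message_valid] by measurable
  ultimately show ?thesis
    using Q.measure_slice[of "\<lambda>\<omega>. rvZ ?P \<omega> = z" x y] by (simp add: map_sample_pmf)
next
  case True
  have "Measurable.pred Q.AB (\<lambda>ab. rvZ one_message_protocol ((x, y), ab) = z)"
    unfolding Q.rvZ_slice using output_measurable[OF one_message_valid] by measurable
  then show ?thesis
    using True Q.measure_slice[of "\<lambda>\<omega>. rvZ one_message_protocol \<omega> = z" x y] by simp
qed

text \<open>The message is a function of \<open>X\<close>, and by \<open>respects\<close> also
  almost surely a function of \<open>(Y, Z)\<close>; each fact gives one of the Markov
  chains.\<close>

lemma one_message_secure: "perfectly_secure pXY pZ one_message_protocol"
proof -
  let ?P = one_message_protocol
  have pred_YZ: "Measurable.pred Q.\<Omega> (\<lambda>\<omega>. (rvY \<omega>, rvZ ?P \<omega>) = v)" for v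
    by (cases v) simp
  have "markov_chain Q.\<Omega> (rvM ?P) rvX (\<lambda>\<omega>. (rvY \<omega>, rvZ ?P \<omega>))"
    by (rule Q.exec.markov_chain_function[where f = F])
      (auto simp: pred_YZ[simplified] one_message_rvM)
  moreover have "markov_chain Q.\<Omega> (rvM ?P) (\<lambda>\<omega>. (rvY \<omega>, rvZ ?P \<omega>)) rvX"
  proof (rule Q.exec.markov_chain_function)
    let ?ok = "\<lambda>x y z. pmf pXY (x, y) > 0 \<and> pmf (pZ x y) z > 0"
    \<comment> \<open>Recovers the message from \<open>(y, z)\<close>: any two inputs able to
      produce this pair are equal or related by \<open>sim\<close>, so the choice does not affect
      the value of \<open>F\<close>.\<close>
    define f where "f = (\<lambda>(y, z). F (SOME x. ?ok x y z))"
    have f: "F x = f (y, z)" if "?ok x y z" for x y z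
    proof -
      let ?x = "SOME x. ?ok x y z"
      have "?ok ?x y z" using that by (rule someI)
      then have "x = ?x \<or> sim pXY pZ x ?x" using that unfolding sim_def by blast
      then show ?thesis using respects unfolding f_def by auto
    qed
    have "AE \<omega> in Q.\<Omega>. \<not> ?ok x y z \<longrightarrow> \<not> (rvZ ?P \<omega> = z \<and> rvX \<omega> = x \<and> rvY \<omega> = y)" for x y z
    proof (cases "?ok x y z")
      case False
      then have "pmf pXY (x, y) * pmf (pZ x y) z = 0"
        by (metis mult_eq_0_iff order_le_less pmf_nonneg)
      then have "\<P>(\<omega> in Q.\<Omega>. rvZ ?P \<omega> = z \<and> rvX \<omega> = x \<and> rvY \<omega> = y) = 0"
        by (simp only: one_message_measure_XYZ)
      then have "AE \<omega> in Q.\<Omega>. \<not> (rvZ ?P \<omega> = z \<and> rvX \<omega> = x \<and> rvY \<omega> = y)"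
        by (subst (asm) Q.exec.prob_Collect_eq_0) auto
      then show ?thesis by eventually_elim blast
    qed simp
    then have "AE \<omega> in Q.\<Omega>. \<forall>x y z. \<not> ?ok x y z \<longrightarrow> \<not> (rvZ ?P \<omega> = z \<and> rvX \<omega> = x \<and> rvY \<omega> = y)"
      unfolding AE_all_countable by blast
    then show "AE \<omega> in Q.\<Omega>. rvM ?P \<omega> = f (rvY \<omega>, rvZ ?P \<omega>)"
    proof eventually_elim
      case (elim \<omega>)
      then have "?ok (rvX \<omega>) (rvY \<omega>) (rvZ ?P \<omega>)" by blast
      then show ?case using f one_message_rvM by simp
    qed
  qed (auto simp: pred_YZ[simplified])
  moreover have "\<P>(\<omega> in Q.\<Omega>. rvZ ?P \<omega> = z \<bar> rvX \<omega> = x \<and> rvY \<omega> = y) = pmf (pZ x y) z"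
    if "pmf pXY (x, y) > 0" for x y z
    using that unfolding cond_prob_def
    by (simp add: one_message_measure_XYZ Q.measure_XY)
  ultimately show ?thesis
    unfolding perfectly_secure_def using one_message_valid by blast
qed

end
end
end

section \<open>Chromatic entropy and the reduced problem\<close>

text \<open>Expresses the entropy through the partition into colour classes alone, without the names
  of the colours.\<close>

lemma shannon_entropy_colour_classes:
  fixes p :: "'v::finite pmf" and c :: "'v \<Rightarrow> 'k"
  shows "shannon_entropy (map_pmf c p)
    = - (\<Sum>C\<in>(\<lambda>k. c -` {k}) ` range c. measure_pmf.prob p C * log 2 (measure_pmf.prob p C))"
proof -
  have inj: "inj_on (\<lambda>k. c -` {k}) (range c)" by (rule inj_onI) blast
  have "(\<Sum>k\<in>set_pmf (map_pmf c p). pmf (map_pmf c p) k * log 2 (pmf (map_pmf c p) k))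
      = (\<Sum>k\<in>range c. pmf (map_pmf c p) k * log 2 (pmf (map_pmf c p) k))"
    by (intro sum.mono_neutral_left) (auto simp: pmf_eq_0_set_pmf)
  then show ?thesis
    by (simp add: shannon_entropy_def sum.reindex[OF inj] pmf_map del: set_map_pmf)
qed

lemma chromatic_entropy_eq:
  fixes p :: "'v::finite pmf"
  shows "chromatic_entropy V E p = Inf {shannon_entropy (map_pmf c p) | c. proper_coloring V E c}"
  unfolding chromatic_entropy_def by (simp add: entropy_eq_shannon_entropy)

text \<open>A finite vertex type has finitely many families of subsets, although there are
  infinitely many colourings. Hence the infimum is attained.\<close>

lemma finite_coloring_entropies:
  fixes p :: "'v::finite pmf"
  shows "finite {shannon_entropy (map_pmf c p) | c :: 'v \<Rightarrow> nat. proper_coloring V E c}"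
proof (rule finite_subset)
  let ?H = "\<lambda>\<C>. - (\<Sum>C\<in>\<C>. measure_pmf.prob p C * log 2 (measure_pmf.prob p C))"
  show "{shannon_entropy (map_pmf c p) | c :: 'v \<Rightarrow> nat. proper_coloring V E c} \<subseteq> range ?H"
    unfolding shannon_entropy_colour_classes by auto
qed simp

lemma chromatic_entropy_le:
  fixes p :: "'v::finite pmf"
  assumes "proper_coloring V E c"
  shows "chromatic_entropy V E p \<le> shannon_entropy (map_pmf c p)"
  unfolding chromatic_entropy_eq
  using assms by (intro cInf_lower bdd_below_finite finite_coloring_entropies) auto

lemma chromatic_entropy_attained:
  fixes p :: "'v::finite pmf"
  assumes "proper_coloring V E c\<^sub>0"
  obtains c where "proper_coloring V E c" "chromatic_entropy V E p = shannon_entropy (map_pmf c p)"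
proof -
  let ?S = "{shannon_entropy (map_pmf c p) | c :: 'v \<Rightarrow> nat. proper_coloring V E c}"
  have ne: "?S \<noteq> {}" using assms by auto
  have "Inf ?S \<in> ?S"
    using Min_in[of ?S, OF finite_coloring_entropies ne] cInf_eq_Min[of ?S, OF finite_coloring_entropies ne]
    by (simp only:)
  then obtain c where "Inf ?S = shannon_entropy (map_pmf c p)" "proper_coloring V E c" by blast
  then show ?thesis by (intro that[of c]) (simp_all only: chromatic_entropy_eq)
qed

lemma sum_pmf_eq_expectation:
  fixes f :: "'k \<Rightarrow> real"
  assumes "finite (set_pmf D)"
  shows "(\<Sum>k\<in>set_pmf D. pmf D k * f k) = (\<integral>k. f k \<partial>measure_pmf D)"
  using assms by (subst integral_measure_pmf_real[of "set_pmf D"]) (auto simp: mult.commute)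

lemma XEQ_pmf_eq: "XEQ_pmf pXY rep = map_pmf rep (map_pmf fst pXY)"
  by (simp add: XEQ_pmf_def map_pmf_comp case_prod_unfold)

lemma sim_sym: "sim pXY pZ x x' \<Longrightarrow> sim pXY pZ x' x"
  unfolding sim_def by blast

lemma equivX_sym: "equivX pXY pZ x x' \<Longrightarrow> equivX pXY pZ x' x"
  unfolding equivX_def using symp_rtranclp[of "sim pXY pZ"] sim_sym by (metis sympD sympI)

lemma equivX_trans: "equivX pXY pZ x x' \<Longrightarrow> equivX pXY pZ x' x'' \<Longrightarrow> equivX pXY pZ x x''"
  unfolding equivX_def by (rule rtranclp_trans)

lemma XEQY_pos:
  assumes "pmf (XEQY_pmf pXY rep) (v, y) > 0"
  obtains x where "rep x = v" "pmf pXY (x, y) > 0"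
proof -
  have "(v, y) \<in> set_pmf (XEQY_pmf pXY rep)" using assms by (simp add: set_pmf_iff)
  then obtain x where "rep x = v" "(x, y) \<in> set_pmf pXY" by (auto simp: XEQY_pmf_def)
  then show ?thesis using that pmf_positive by metis
qed

lemma XEQY_posI:
  assumes "pmf pXY (x, y) > 0"
  shows "pmf (XEQY_pmf pXY rep) (rep x, y) > 0"
proof (rule pmf_positive)
  have "(x, y) \<in> set_pmf pXY" using assms by (simp add: set_pmf_iff)
  then show "(rep x, y) \<in> set_pmf (XEQY_pmf pXY rep)" by (force simp: XEQY_pmf_def)
qed

section \<open>Edges of the reduced graph\<close>

locale reduced_problem = secure_execution pXY P pZ
  for pXY :: "('x::finite \<times> 'y::finite) pmf" and P :: "('x, 'y, 'z::finite, 'a, 'b) protocol"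
    and pZ +
  fixes rep :: "'x \<Rightarrow> 'x"
  assumes rep: "representatives pXY pZ rep"
begin

abbreviation "E \<equiv> G_EQ_edges pXY pZ rep"
abbreviation "pEQ \<equiv> XEQ_pmf pXY rep"

lemma equivX_rep: "equivX pXY pZ x (rep x)"
  using rep by (simp add: representatives_def)

lemma rep_eq: "equivX pXY pZ x x' \<Longrightarrow> rep x = rep x'"
  using rep by (simp add: representatives_def)

text \<open>The representative itself may be impossible together with \<open>y\<close>;
  \<open>pZ_equiv\<close> makes any possible member of the class serve equally well.\<close>

lemma pZ_EQ_rep:
  assumes "pmf pXY (x, y) > 0"
  shows "pZ_EQ pXY pZ (rep x) y z = pmf (pZ x y) z"
proof -
  let ?Q = "\<lambda>x'. equivX pXY pZ (rep x) x' \<and> pmf pXY (x', y) > 0"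
  have "?Q x" using assms equivX_sym[OF equivX_rep] by blast
  then have ex: "\<exists>x'. ?Q x'" by blast
  then have Q: "?Q (SOME x'. ?Q x')" by (rule someI_ex)
  then have "pZ (SOME x'. ?Q x') y = pZ x y"
    using assms equivX_trans[OF equivX_rep] by (intro pZ_equiv[symmetric]) auto
  then show ?thesis using ex by (simp add: pZ_EQ_def)
qed

text \<open>The endpoints differ because their output laws do, so the graph has no loops.\<close>

lemma edgeE:
  assumes "{u, v} \<in> E"
  obtains x x' y where "rep x = u" "rep x' = v" "pmf pXY (x, y) > 0" "pmf pXY (x', y) > 0" "u \<noteq> v"
proof -
  obtain xi xj y z where *: "{u, v} = {xi, xj}" "pmf (XEQY_pmf pXY rep) (xi, y) > 0"
      "pmf (XEQY_pmf pXY rep) (xj, y) > 0" "pZ_EQ pXY pZ xi y z \<noteq> pZ_EQ pXY pZ xj y z"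
    using assms unfolding G_EQ_edges_def by blast
  obtain x where x: "rep x = xi" "pmf pXY (x, y) > 0" using XEQY_pos[OF *(2)] .
  obtain x' where x': "rep x' = xj" "pmf pXY (x', y) > 0" using XEQY_pos[OF *(3)] .
  have "xi \<noteq> xj" using *(4) by auto
  then show ?thesis using *(1) x x' that by (auto simp: doubleton_eq_iff)
qed

lemma edgeI:
  assumes "pmf pXY (x, y) > 0" "pmf pXY (x', y) > 0" "pZ x y \<noteq> pZ x' y"
  shows "{rep x, rep x'} \<in> E"
proof -
  obtain z where "pmf (pZ x y) z \<noteq> pmf (pZ x' y) z" using assms(3) pmf_eqI by metis
  then have "pZ_EQ pXY pZ (rep x) y z \<noteq> pZ_EQ pXY pZ (rep x') y z"
    using assms by (simp add: pZ_EQ_rep)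
  moreover have "pmf (XEQY_pmf pXY rep) (rep x, y) > 0" "pmf (XEQY_pmf pXY rep) (rep x', y) > 0"
    using assms by (auto intro: XEQY_posI)
  ultimately show ?thesis
    unfolding G_EQ_edges_def by (intro CollectI exI[of _ "rep x"] exI[of _ "rep x'"]) auto
qed

section \<open>Lower bound on the rate\<close>

definition shortest :: "'x \<Rightarrow> bool list" where
  "shortest x = (ARG_MIN length m. msg_law x m > 0)"

lemma shortest: "msg_law x (shortest x) > 0" "msg_law x m > 0 \<Longrightarrow> length (shortest x) \<le> length m"
proof -
  obtain m\<^sub>0 where "msg_law x m\<^sub>0 > 0" using ex_msg_law_pos by blast
  note * = arg_min_nat_lemma[of "\<lambda>m. msg_law x m > 0", OF this, of length, folded shortest_def]
  show "msg_law x (shortest x) > 0" using * by (rule conjunct1)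
  show "msg_law x m > 0 \<Longrightarrow> length (shortest x) \<le> length m" using * by simp
qed

lemma shortest_rep: "shortest (rep x) = shortest x"
  using msg_law_equiv[OF equivX_rep, of x] by (simp add: shortest_def)

text \<open>If the ends of an edge had the same word, two members sharing a \<open>y\<close> would
  share a possible transcript. By \<open>msg_law_common\<close> they would be equivalent, and the
  edge would be a loop.\<close>

lemma proper_shortest: "proper_coloring (range rep) E (\<lambda>v. to_nat (shortest v))"
  unfolding proper_coloring_def
proof (intro ballI impI notI)
  fix u v assume edge: "{u, v} \<in> E" and eq: "to_nat (shortest u) = to_nat (shortest v)"
  obtain x x' y where x: "rep x = u" "rep x' = v" "pmf pXY (x, y) > 0" "pmf pXY (x', y) > 0"
      "u \<noteq> v"
    using edgeE[OF edge] .
  have "shortest x = shortest x'"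
    using eq x(1,2) shortest_rep[of x] shortest_rep[of x'] by simp
  then have "equivX pXY pZ x x'"
    using msg_law_common[OF x(3,4) shortest(1)[of x]] shortest(1)[of x'] by simp
  then show False using rep_eq x by blast
qed

lemma chromatic_entropy_le_rate:
  "ennreal (chromatic_entropy (range rep) E pEQ) \<le> rate pXY P"
proof -
  define c where "c v = to_nat (shortest v)" for v
  \<comment> \<open>The codeword of a colour is the transcript that it encodes.\<close>
  let ?D = "map_pmf c pEQ" and ?w = "from_nat :: nat \<Rightarrow> bool list"
  have fin: "finite (set_pmf ?D)" by simp
  have set: "set_pmf ?D \<subseteq> range c" by auto
  have "inj_on ?w (set_pmf ?D)"
    using set by (auto simp: inj_on_def c_def subset_iff image_iff)
  moreover have "prefix_free (?w ` set_pmf ?D)"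
    using msg_law_prefix_free shortest(1) unfolding prefix_free_def by (force simp: c_def)
  ultimately have "shannon_entropy ?D \<le> (\<Sum>k\<in>set_pmf ?D. pmf ?D k * length (?w k))"
    by (intro shannon_entropy_le_length fin)
  also have "\<dots> = (\<integral>x. real (length (shortest x)) \<partial>measure_pmf (map_pmf fst pXY))"
    by (subst sum_pmf_eq_expectation[OF fin])
      (simp add: XEQ_pmf_eq c_def shortest_rep map_pmf_comp)
  finally have "ennreal (chromatic_entropy (range rep) E pEQ)
      \<le> ennreal (\<integral>x. real (length (shortest x)) \<partial>measure_pmf (map_pmf fst pXY))"
    using chromatic_entropy_le[OF proper_shortest, of pEQ]
    by (intro ennreal_leI) (simp add: c_def[abs_def])
  also have "\<dots> = (\<integral>\<^sup>+\<omega>. ennreal (real (length (shortest (rvX \<omega>)))) \<partial>\<Omega>)"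
    by (simp only: nn_integral_rvX[of "\<lambda>x. real (length (shortest x))", OF of_nat_0_le_iff])
  also have "\<dots> \<le> rate pXY P"
    unfolding rate_def
  proof (rule nn_integral_mono_AE)
    \<comment> \<open>The transcript sent is almost surely possible for its input, hence no shorter
      than the shortest possible one.\<close>
    show "AE \<omega> in \<Omega>. ennreal (real (length (shortest (rvX \<omega>)))) \<le> of_nat (length (rvM P \<omega>))"
      using AE_msg_law_pos
      by eventually_elim (simp add: shortest(2) flip: ennreal_of_nat_eq_real_of_nat)
  qed
  finally show ?thesis .
qed

section \<open>Upper bound on the optimal rate\<close>

lemma ex_protocol_rate_less:
  "\<exists>Q :: ('x, 'y, 'z, real, real) protocol. perfectly_secure pXY pZ Q \<and>
     rate pXY Q < ennreal (chromatic_entropy (range rep) E pEQ + 1)"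
proof -
  obtain c where c: "proper_coloring (range rep) E c"
      "chromatic_entropy (range rep) E pEQ = shannon_entropy (map_pmf c pEQ)"
    using chromatic_entropy_attained[OF proper_shortest] .
  let ?D = "map_pmf c pEQ"
  have fin: "finite (set_pmf ?D)" by simp
  \<comment> \<open>Full support of \<open>X\<close> gives every colour in use positive probability,
    so the Shannon code assigns distinct words to all of them.\<close>
  have set: "set_pmf ?D = range (\<lambda>x. c (rep x))"
    using full_X by (simp add: XEQ_pmf_eq image_image flip: set_map_pmf)
      (simp add: image_comp comp_def)
  obtain w :: "nat \<Rightarrow> bool list" where w: "inj_on w (set_pmf ?D)" "prefix_free (w ` set_pmf ?D)"
      "(\<Sum>k\<in>set_pmf ?D. pmf ?D k * length (w k)) < shannon_entropy ?D + 1"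
    using shannon_code[OF fin] by blast
  define F where "F x = w (c (rep x))" for x
  have F_eq: "F x = F x' \<Longrightarrow> c (rep x) = c (rep x')" for x x'
    using w(1) unfolding F_def inj_on_def set by blast
  have "w ` set_pmf ?D = range F" unfolding set by (auto simp: F_def)
  then have pf: "prefix_free (range F)" using w(2) by (simp only:)
  \<comment> \<open>Different output laws at a common \<open>y\<close> would give an edge, hence
    different colours and different codewords.\<close>
  have compatible: "pZ x y = pZ x' y"
    if "pmf pXY (x, y) > 0" "pmf pXY (x', y) > 0" "F x = F x'" for x x' y
    using edgeI[OF that(1,2)] c(1) F_eq[OF that(3)] unfolding proper_coloring_def by blast
  have respects: "F x = F x'" if "sim pXY pZ x x'" for x x'
    using rep_eq[of x x'] that by (simp add: equivX_def F_def r_into_rtranclp)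
  let ?Q = "one_message_protocol pXY pZ F"
  have "perfectly_secure pXY pZ ?Q"
    using pf compatible respects by (rule one_message_secure)
  moreover have "rate pXY ?Q = ennreal (\<Sum>k\<in>set_pmf ?D. pmf ?D k * length (w k))"
    by (subst sum_pmf_eq_expectation[OF fin])
      (simp add: one_message_rate[OF pf] XEQ_pmf_eq F_def map_pmf_comp)
  ultimately show ?thesis
    using w(3) c(2) by (intro exI[of _ ?Q]) (simp add: ennreal_less_iff sum_nonneg)
qed

end

text \<open>The upper bound asserts existence, because a given protocol can be padded with useless
  bits. The protocol \<open>P\<close> enters this part through the constancy of the output law on
  classes and the proper colouring by shortest transcripts.\<close>

theorem theorem2:
  fixes pXY :: "('x::finite \<times> 'y::finite) pmf"
    and pZ :: "'x \<Rightarrow> 'y \<Rightarrow> 'z::finite pmf"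
    and rep :: "'x \<Rightarrow> 'x"
    and P :: "('x, 'y, 'z, 'a, 'b) protocol"
  assumes full_X: "set_pmf (map_pmf fst pXY) = UNIV"
    and full_Y: "set_pmf (map_pmf snd pXY) = UNIV"
    and full_Z: "set_pmf (bind_pmf pXY (\<lambda>(x, y). pZ x y)) = UNIV"
    and rep: "representatives pXY pZ rep"
    and secure: "perfectly_secure pXY pZ P"
  shows "ennreal (chromatic_entropy (range rep) (G_EQ_edges pXY pZ rep) (XEQ_pmf pXY rep))
           \<le> rate pXY P \<and>
         (\<exists>Q :: ('x, 'y, 'z, real, real) protocol. perfectly_secure pXY pZ Q \<and>
            rate pXY Q
              < ennreal (chromatic_entropy (range rep) (G_EQ_edges pXY pZ rep) (XEQ_pmf pXY rep) + 1))"
proof -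
  interpret reduced_problem pXY P pZ rep
    using full_X rep secure by unfold_locales (auto simp: perfectly_secure_def)
  show ?thesis using chromatic_entropy_le_rate ex_protocol_rate_less by blast
qed

end
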